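(* Let $G$ be a $\mathbb Z$-central extension of a hyperbolic group, that is, $G$ is a group fitting in a central extension $\mathbb Z\hookrightarrow G\twoheadrightarrow H$ for some hyperbolic group $H$. Then there is an algorithm that takes as input a word in the generating set of $G$ and determines whether it represents an element of (the image of) $\mathbb Z$, and if so which one, and which runs in time linear in the length of the input word.
   Context: Algorithms are implemented on multi-tape Turing machines. The generating set is a fixed finite generating set of $G$. Integers are stored on a Turing machine in unary, as strings of the symbol "$1$" or of the symbol "$-1$". The extension being central means that the image of $\mathbb Z$ is contained in the centre of $G$ and is the kernel of $G\twoheadrightarrow H$. *)

theory Defs
  imports Complex_Main "HOL-Algebra.Generated_Groups" "HOL-Algebra.Elementary_Groups"
begin

text \<open>A letter over a set \<open>X\<close> of generators is a formal symbol \<open>(x, True)\<close>, standing for \<open>x\<close>,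
  or \<open>(x, False)\<close>, standing for the inverse of \<open>x\<close>.  The two are distinct symbols even if
  they denote the same group element.\<close>

definition words :: "'a set \<Rightarrow> ('a \<times> bool) list set" where
  "words X = lists (X \<times> UNIV)"

definition letter_val :: "('a, 'm) monoid_scheme \<Rightarrow> 'a \<times> bool \<Rightarrow> 'a" where
  "letter_val G l = (if snd l then fst l else inv\<^bsub>G\<^esub> (fst l))"

definition word_val :: "('a, 'm) monoid_scheme \<Rightarrow> ('a \<times> bool) list \<Rightarrow> 'a" where
  "word_val G w = foldr (\<lambda>l g. letter_val G l \<otimes>\<^bsub>G\<^esub> g) w \<one>\<^bsub>G\<^esub>"

definition finite_generating_set :: "('a, 'm) monoid_scheme \<Rightarrow> 'a set \<Rightarrow> bool" where
  "finite_generating_set G X \<longleftrightarrow> finite X \<and> X \<subseteq> carrier G \<and> generate G X = carrier G"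

text \<open>The next two notions are only meaningful if \<open>X\<close> generates \<open>G\<close>; otherwise the set of lengths
  may be empty.\<close>

definition word_length :: "('a, 'm) monoid_scheme \<Rightarrow> 'a set \<Rightarrow> 'a \<Rightarrow> nat" where
  "word_length G X g = (LEAST n. \<exists>w \<in> words X. length w = n \<and> word_val G w = g)"

definition word_dist :: "('a, 'm) monoid_scheme \<Rightarrow> 'a set \<Rightarrow> 'a \<Rightarrow> 'a \<Rightarrow> real" where
  "word_dist G X g h = real (word_length G X (inv\<^bsub>G\<^esub> g \<otimes>\<^bsub>G\<^esub> h))"

definition gromov_product :: "('a \<Rightarrow> 'a \<Rightarrow> real) \<Rightarrow> 'a \<Rightarrow> 'a \<Rightarrow> 'a \<Rightarrow> real" where
  "gromov_product d p x y = (d x p + d y p - d x y) / 2"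

definition gromov_hyperbolic_on :: "'a set \<Rightarrow> ('a \<Rightarrow> 'a \<Rightarrow> real) \<Rightarrow> real \<Rightarrow> bool" where
  "gromov_hyperbolic_on S d \<delta> \<longleftrightarrow>
     (\<forall>p \<in> S. \<forall>x \<in> S. \<forall>y \<in> S. \<forall>z \<in> S.
        gromov_product d p x z \<ge> min (gromov_product d p x y) (gromov_product d p y z) - \<delta>)"

text \<open>Gromov's definition.  Hyperbolicity does not depend on the finite generating set, so
  asking for one such set is the same as asking it of all of them.\<close>

definition hyperbolic_group :: "('a, 'm) monoid_scheme \<Rightarrow> bool" where
  "hyperbolic_group G \<longleftrightarrow> group G \<and>
     (\<exists>X \<delta>. finite_generating_set G X \<and> gromov_hyperbolic_on (carrier G) (word_dist G X) \<delta>)"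

definition Z_central_extension ::
  "('a, 'm) monoid_scheme \<Rightarrow> ('b, 'n) monoid_scheme \<Rightarrow> (int \<Rightarrow> 'a) \<Rightarrow> ('a \<Rightarrow> 'b) \<Rightarrow> bool" where
  "Z_central_extension G H \<iota> \<pi> \<longleftrightarrow>
     group G \<and> group H \<and>
     \<iota> \<in> mon integer_group G \<and> \<pi> \<in> epi G H \<and> range \<iota> = kernel G H \<pi> \<and>
     (\<forall>n. \<forall>g \<in> carrier G. \<iota> n \<otimes>\<^bsub>G\<^esub> g = g \<otimes>\<^bsub>G\<^esub> \<iota> n)"

text \<open>\<open>Letter a\<close> is an input letter, \<open>One\<close> and \<open>Minus_One\<close> are the symbols ``1'' and ``-1'' of the
  unary notation, and \<open>Aux i\<close> are further working symbols; a machine uses only finitely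
  many of these symbols.\<close>

datatype 'a symbol = Blank | Letter 'a | One | Minus_One | Aux nat

datatype head_move = Move_Left | Stay | Move_Right

text \<open>A tape is infinite in both directions; the integer is the position of the head.\<close>

type_synonym 'a tape = "(int \<Rightarrow> 'a symbol) \<times> int"

text \<open>In state \<open>q\<close>, reading the symbols \<open>xs\<close> on the tapes, the machine goes over to the
  state \<open>fst (tm_delta M q xs)\<close>, and on each tape writes a symbol and moves the head as
  prescribed by \<open>snd (tm_delta M q xs)\<close>.\<close>

record 'a turing_machine =
  tm_tapes :: nat
  tm_states :: "nat set"
  tm_alphabet :: "'a symbol set"
  tm_start :: nat
  tm_accept :: nat
  tm_reject :: nat
  tm_delta :: "nat \<Rightarrow> 'a symbol list \<Rightarrow> nat \<times> ('a symbol \<times> head_move) list"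

text \<open>The first tape is the input tape and the second one is the output tape, whence
  the lower bound on the number of tapes.\<close>

definition valid_tm :: "'a turing_machine \<Rightarrow> bool" where
  "valid_tm M \<longleftrightarrow>
     2 \<le> tm_tapes M \<and> finite (tm_states M) \<and> finite (tm_alphabet M) \<and>
     {Blank, One, Minus_One} \<subseteq> tm_alphabet M \<and>
     {tm_start M, tm_accept M, tm_reject M} \<subseteq> tm_states M \<and> tm_accept M \<noteq> tm_reject M \<and>
     (\<forall>q \<in> tm_states M. \<forall>xs \<in> lists (tm_alphabet M). length xs = tm_tapes M \<longrightarrow>
        fst (tm_delta M q xs) \<in> tm_states M \<and>
        length (snd (tm_delta M q xs)) = tm_tapes M \<and>
        fst ` set (snd (tm_delta M q xs)) \<subseteq> tm_alphabet M)"

type_synonym 'a config = "nat \<times> 'a tape list"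

definition tape_read :: "'a tape \<Rightarrow> 'a symbol" where
  "tape_read t = fst t (snd t)"

fun move_head :: "head_move \<Rightarrow> int \<Rightarrow> int" where
  "move_head Move_Left i = i - 1"
| "move_head Stay i = i"
| "move_head Move_Right i = i + 1"

definition tape_act :: "'a symbol \<times> head_move \<Rightarrow> 'a tape \<Rightarrow> 'a tape" where
  "tape_act a t = ((fst t)(snd t := fst a), move_head (snd a) (snd t))"

definition halted :: "'a turing_machine \<Rightarrow> 'a config \<Rightarrow> bool" where
  "halted M c \<longleftrightarrow> fst c \<in> {tm_accept M, tm_reject M}"

definition tm_step :: "'a turing_machine \<Rightarrow> 'a config \<Rightarrow> 'a config" where
  "tm_step M c =
     (if halted M c then c
      else let (q, acts) = tm_delta M (fst c) (map tape_read (snd c))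
           in (q, map2 tape_act acts (snd c)))"

definition tape_content :: "'a symbol list \<Rightarrow> int \<Rightarrow> 'a symbol" where
  "tape_content xs i = (if 0 \<le> i \<and> i < int (length xs) then xs ! nat i else Blank)"

definition initial_config :: "'a turing_machine \<Rightarrow> 'a list \<Rightarrow> 'a config" where
  "initial_config M w =
     (tm_start M,
      (tape_content (map Letter w), 0) # replicate (tm_tapes M - 1) (tape_content [], 0))"

definition config_after :: "'a turing_machine \<Rightarrow> 'a list \<Rightarrow> nat \<Rightarrow> 'a config" where
  "config_after M w t = (tm_step M ^^ t) (initial_config M w)"

definition output_tape :: "'a config \<Rightarrow> int \<Rightarrow> 'a symbol" where
  "output_tape c = fst (snd c ! 1)"

definition unary :: "int \<Rightarrow> 'a symbol list" where
  "unary n = (if 0 \<le> n then replicate (nat n) One else replicate (nat (- n)) Minus_One)"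

text \<open>On the inputs from \<open>L\<close>, the machine \<open>M\<close> computes the partial function \<open>f\<close> in time
  \<open>T\<close> (a function of the input length) and decides its domain: it rejects the input \<open>w\<close> if
  \<open>f w\<close> is undefined, and otherwise accepts with precisely the unary string for the value of \<open>f w\<close>
  on the output tape.\<close>

definition decides_and_computes ::
  "'a turing_machine \<Rightarrow> 'a list set \<Rightarrow> ('a list \<Rightarrow> int option) \<Rightarrow> (nat \<Rightarrow> nat) \<Rightarrow> bool" where
  "decides_and_computes M L f T \<longleftrightarrow>
     (\<forall>w \<in> L. \<exists>t \<le> T (length w).
        (case f w of
           None \<Rightarrow> fst (config_after M w t) = tm_reject M
         | Some n \<Rightarrow> fst (config_after M w t) = tm_accept M \<and>
                     output_tape (config_after M w t) = tape_content (unary n)))"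

definition Z_value ::
  "('g, 'm) monoid_scheme \<Rightarrow> (int \<Rightarrow> 'g) \<Rightarrow> ('g \<times> bool) list \<Rightarrow> int option" where
  "Z_value G \<iota> w =
     (if word_val G w \<in> range \<iota> then Some (THE n. \<iota> n = word_val G w) else None)"

end

theory Submission
  imports Defs
begin

text \<open>The algorithm is Dehn's algorithm in \<open>H\<close>, run on lifts to \<open>G\<close> and with a
  counter for the central part that it discards.

  In a \<open>\<delta>\<close>-hyperbolic group a nonempty word all of whose factors of length at most \<open>2m\<close> are
  geodesic is nontrivial as soon as \<open>m > 2\<delta>\<close>
  (\<open>locally_geodesic_word_nontrivial\<close>).  So the word problem of \<open>H\<close> is solved by
  replacing short non-geodesic factors by shorter words until none is left: the word is
  trivial iff nothing remains.

  Choose for every letter over the generators \<open>Y\<close> of \<open>H\<close> a preimage in \<open>G\<close>.  A letter over the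
  generators of \<open>G\<close> then equals a word in these lifts up to a central integer, and a rule \<open>u \<mapsto> v\<close>
  of Dehn's algorithm holds for the lifts up to a central integer, because both sides have the
  same image in \<open>H\<close>.  Only finitely many letters and rules occur, so all these integers are
  bounded.  Adding them up in a counter turns the input into \<open>\<iota> n\<close> times the lift of a locally
  geodesic word (\<open>dehn_step_state_val\<close>).  If that word is empty, the input is \<open>\<iota> n\<close>; otherwise its
  image in \<open>H\<close> is nontrivial, so it is not in the range of \<open>\<iota>\<close>.

  Linear time needs the rewriting to be organised around two stacks: one holds the part already
  known to be locally geodesic, its topmost letters being kept in the finite control, and the
  other holds the part still to be read, onto which the right hand side of a rule is pushed
  back.  Since every rule shortens the word, a linear potential decreases with each
  step (\<open>dehn_step_potential\<close>).  A step costs boundedly many moves of a Turing machine, whose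
  states are a control state together with a list of pending tape actions (\<open>scripted_machine\<close>).\<close>

section \<open>Values of words\<close>

text \<open>Not only words over the generators take values in the extension group, but also words over the lifted
  generators of the quotient, and the mixed words on the input tape during the computation.  Hence
  the interpretation of the letters is a parameter.\<close>

definition list_prod :: "('a, 'm) monoid_scheme \<Rightarrow> ('l \<Rightarrow> 'a) \<Rightarrow> 'l list \<Rightarrow> 'a" where
  "list_prod G f w = foldr (\<lambda>l g. f l \<otimes>\<^bsub>G\<^esub> g) w \<one>\<^bsub>G\<^esub>"

lemma word_val_eq_list_prod: "word_val G = list_prod G (letter_val G)"
  by (simp add: fun_eq_iff word_val_def list_prod_def)

lemma list_prod_Nil [simp]: "list_prod G f [] = \<one>\<^bsub>G\<^esub>"
  and list_prod_Cons [simp]: "list_prod G f (l # w) = f l \<otimes>\<^bsub>G\<^esub> list_prod G f w"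
  by (simp_all add: list_prod_def)

lemma list_prod_cong:
  "(\<And>l. l \<in> set w \<Longrightarrow> f l = g l) \<Longrightarrow> list_prod G f w = list_prod G g w"
  by (induction w) simp_all

lemma list_prod_map: "list_prod G f (map h w) = list_prod G (f \<circ> h) w"
  by (induction w) simp_all

section \<open>Locally geodesic words in hyperbolic groups\<close>

definition geodesic :: "('a, 'm) monoid_scheme \<Rightarrow> 'a set \<Rightarrow> ('a \<times> bool) list \<Rightarrow> bool" where
  "geodesic G X u \<longleftrightarrow> length u = word_length G X (word_val G u)"

definition every_factor :: "nat \<Rightarrow> ('l list \<Rightarrow> bool) \<Rightarrow> 'l list \<Rightarrow> bool" where
  "every_factor k P w \<longleftrightarrow> (\<forall>p u s. w = p @ u @ s \<longrightarrow> length u \<le> k \<longrightarrow> P u)"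

lemma every_factor_prefix: "every_factor k P (p @ s) \<Longrightarrow> every_factor k P p"
  unfolding every_factor_def by (metis append.assoc)

text \<open>A factor not already present in \<open>p @ u\<close> ends with the new letter.  If it is short, it is a suffix
  of \<open>u @ [l]\<close>, so that looking at a bounded window suffices when a letter is appended.\<close>

lemma every_factor_snoc:
  assumes fac: "every_factor k P (p @ u)" and suffix: "\<And>r v. u @ [l] = r @ v \<Longrightarrow> P v"
    and long: "k \<le> length u + 1 \<or> p = []"
  shows "every_factor k P (p @ u @ [l])"
  unfolding every_factor_def
proof (intro allI impI)
  fix p' u' s' assume eq: "p @ u @ [l] = p' @ u' @ s'" and len: "length u' \<le> k"
  show "P u'"
  proof (cases s' rule: rev_cases)
    case Nil
    have eq': "p @ (u @ [l]) = p' @ u'" using eq Nil by simp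
    show ?thesis
    proof (cases "p = []")
      case True
      then show ?thesis using suffix[of p' u'] eq' by simp
    next
      case False
      then have "length u' \<le> length (u @ [l])" using long len by simp
      then have "length p \<le> length p'"
        using arg_cong[OF eq', of length] by simp
      then have "u' = drop (length p' - length p) (u @ [l])"
        using arg_cong[OF eq', of "drop (length p')"] by (simp del: append_assoc)
      then show ?thesis using suffix by (metis append_take_drop_id)
    qed
  next
    case (snoc s x)
    then have "p @ u = p' @ u' @ s"
      using eq by (metis append.assoc butlast_snoc)
    then show ?thesis using fac len unfolding every_factor_def by blast
  qed
qed

context group
begin

lemma list_prod_closed [simp]:
  "(\<And>l. l \<in> set w \<Longrightarrow> f l \<in> carrier G) \<Longrightarrow> list_prod G f w \<in> carrier G"
  by (induction w) simp_all

lemma list_prod_append: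
  assumes "\<And>l. l \<in> set (v @ w) \<Longrightarrow> f l \<in> carrier G"
  shows "list_prod G f (v @ w) = list_prod G f v \<otimes> list_prod G f w"
  using assms by (induction v) (simp_all add: m_assoc)

lemma list_prod_hom:
  assumes "group H" "\<pi> \<in> hom G H" "\<And>l. l \<in> set w \<Longrightarrow> f l \<in> carrier G"
  shows "\<pi> (list_prod G f w) = list_prod H (\<pi> \<circ> f) w"
  using assms(3)
proof (induction w)
  case Nil
  then show ?case using hom_one[OF assms(2) is_group assms(1)] by simp
next
  case (Cons l w)
  then show ?case using hom_mult[OF assms(2)] by simp
qed

lemma letter_val_closed: "X \<subseteq> carrier G \<Longrightarrow> l \<in> X \<times> UNIV \<Longrightarrow> letter_val G l \<in> carrier G"
  by (auto simp: letter_val_def)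

lemma word_letter_closed:
  "X \<subseteq> carrier G \<Longrightarrow> w \<in> words X \<Longrightarrow> l \<in> set w \<Longrightarrow> letter_val G l \<in> carrier G"
  by (auto simp: words_def intro!: letter_val_closed)

lemma word_val_closed: "X \<subseteq> carrier G \<Longrightarrow> w \<in> words X \<Longrightarrow> word_val G w \<in> carrier G"
  unfolding word_val_eq_list_prod by (rule list_prod_closed) (rule word_letter_closed)

lemma word_val_append:
  assumes "X \<subseteq> carrier G" "v \<in> words X" "w \<in> words X"
  shows "word_val G (v @ w) = word_val G v \<otimes> word_val G w"
  unfolding word_val_eq_list_prod
  by (rule list_prod_append) (use assms word_letter_closed in auto)

lemma generate_imp_word:
  assumes "X \<subseteq> carrier G" "g \<in> generate G X"
  shows "\<exists>w \<in> words X. word_val G w = g"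
  using assms(2)
proof induction
  case one
  show ?case by (rule bexI[of _ "[]"]) (simp_all add: word_val_def words_def)
next
  case (incl h)
  then show ?case using assms(1)
    by (intro bexI[of _ "[(h, True)]"]) (auto simp: word_val_def words_def letter_val_def)
next
  case (inv h)
  then show ?case using assms(1)
    by (intro bexI[of _ "[(h, False)]"]) (auto simp: word_val_def words_def letter_val_def)
next
  case (eng g h)
  then obtain v w where "v \<in> words X" "w \<in> words X" "word_val G v = g" "word_val G w = h"
    by blast
  then show ?case
    using word_val_append[OF assms(1), of v w] by (intro bexI[of _ "v @ w"]) (auto simp: words_def)
qed

lemma inverse_word:
  assumes X: "X \<subseteq> carrier G" and "w \<in> words X"
  shows "\<exists>v \<in> words X. length v = length w \<and> word_val G v = inv (word_val G w)"
  using assms(2)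
proof (induction w)
  case Nil
  show ?case by (rule bexI[of _ "[]"]) (simp_all add: word_val_def words_def)
next
  case (Cons l w)
  then have l: "l \<in> X \<times> UNIV" and w: "w \<in> words X" by (auto simp: words_def)
  obtain v where v: "v \<in> words X" "length v = length w" "word_val G v = inv (word_val G w)"
    using Cons.IH[OF w] by blast
  define l' where "l' = (fst l, \<not> snd l)"
  have l': "[l'] \<in> words X" using l by (auto simp: words_def l'_def)
  have "letter_val G l' = inv (letter_val G l)"
    using l X by (auto simp: l'_def letter_val_def)
  then have "word_val G [l'] = inv (letter_val G l)"
    using letter_val_closed[OF X l] by (simp add: word_val_eq_list_prod)
  then have "word_val G (v @ [l']) = inv (word_val G w) \<otimes> inv (letter_val G l)"
    using word_val_append[OF X v(1) l'] v(3) by simp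
  also have "\<dots> = inv (word_val G (l # w))"
    using inv_mult_group[OF letter_val_closed[OF X l] word_val_closed[OF X w]]
    by (simp add: word_val_eq_list_prod)
  finally show ?case
    using v l' by (intro bexI[of _ "v @ [l']"]) (auto simp: words_def)
qed

lemma word_length_le: "w \<in> words X \<Longrightarrow> word_length G X (word_val G w) \<le> length w"
  unfolding word_length_def by (rule Least_le) blast

lemma word_length_attained:
  assumes "u \<in> words X"
  shows "\<exists>w \<in> words X. length w = word_length G X (word_val G u) \<and> word_val G w = word_val G u"
  unfolding word_length_def by (rule LeastI[of _ "length u"]) (use assms in blast)

lemma word_length_one [simp]: "word_length G X \<one> = 0"
  using word_length_le[of "[]" X] by (simp add: words_def word_val_def)

lemma word_length_inv:
  assumes gen: "finite_generating_set G X" and g: "g \<in> carrier G"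
  shows "word_length G X (inv g) = word_length G X g"
proof -
  have X: "X \<subseteq> carrier G" and gX: "generate G X = carrier G"
    using gen by (auto simp: finite_generating_set_def)
  have le: "word_length G X (inv h) \<le> word_length G X h" if h: "h \<in> carrier G" for h
  proof -
    obtain w where w: "w \<in> words X" "length w = word_length G X h" "word_val G w = h"
      using generate_imp_word[OF X, of h] word_length_attained[of _ X] gX h by metis
    obtain v where "v \<in> words X" "length v = length w" "word_val G v = inv h"
      using inverse_word[OF X w(1)] w(3) by blast
    then show ?thesis using word_length_le[of v X] w(2) by simp
  qed
  show ?thesis using le[of g] le[of "inv g"] g by simp
qed

lemma word_dist_sym:
  assumes gen: "finite_generating_set G X" and "g \<in> carrier G" "h \<in> carrier G"
  shows "word_dist G X g h = word_dist G X h g"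
  using word_length_inv[OF gen, of "inv g \<otimes> h"] assms by (simp add: word_dist_def inv_mult_group)

lemma not_geodesic_imp_shorter:
  assumes X: "X \<subseteq> carrier G" and u: "u \<in> words X" and "\<not> geodesic G X u"
  shows "\<exists>v \<in> words X. length v < length u \<and> word_val G v = word_val G u"
proof -
  obtain v where "v \<in> words X" "word_val G v = word_val G u"
      "length v = word_length G X (word_val G u)"
    using word_length_attained[OF u] by blast
  then show ?thesis
    using assms(3) word_length_le[OF u] unfolding geodesic_def by (intro bexI[of _ v]) auto
qed

lemma geodesic_suffix:
  assumes X: "X \<subseteq> carrier G" and w: "p @ u \<in> words X" and "geodesic G X (p @ u)"
  shows "geodesic G X u"
proof (rule ccontr)
  assume n: "\<not> geodesic G X u"
  have p: "p \<in> words X" and u: "u \<in> words X" using w by (auto simp: words_def)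
  obtain v where v: "v \<in> words X" "length v < length u" "word_val G v = word_val G u"
    using not_geodesic_imp_shorter[OF X u n] by blast
  have "word_val G (p @ v) = word_val G (p @ u)"
    using word_val_append[OF X p] u v by simp
  moreover have "p @ v \<in> words X" using p v by (auto simp: words_def)
  ultimately show False
    using word_length_le[of "p @ v" X] v(2) assms(3) by (simp add: geodesic_def)
qed

text \<open>Let \<open>p\<^sub>i\<close> be the vertices of the path labelled by \<open>w\<close>.  The Gromov product of \<open>p\<^sub>0\<close> and \<open>p\<^bsub>n+m\<^esub>\<close> at
  \<open>p\<^sub>n\<close> stays below \<open>\<delta>\<close>, by induction on \<open>n\<close> in steps of \<open>m\<close>: the product of \<open>p\<^bsub>n-m\<^esub>\<close> and \<open>p\<^bsub>n+m\<^esub>\<close> at \<open>p\<^sub>n\<close>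
  is \<open>0\<close> because these points lie on a common geodesic (for \<open>n < m\<close> this applies to \<open>p\<^sub>0\<close> directly), whereas the product of \<open>p\<^bsub>n-m\<^esub>\<close> and \<open>p\<^sub>0\<close> at
  \<open>p\<^sub>n\<close> is at least \<open>m - \<delta> > \<delta>\<close> by induction hypothesis, and hyperbolicity forces the third one to be
  small.  Consequently the last \<open>m\<close> letters increase the distance from \<open>p\<^sub>0\<close> by at least \<open>m - 2\<delta> > 0\<close>.\<close>

theorem locally_geodesic_word_nontrivial:
  assumes gen: "finite_generating_set G X"
    and hyp: "gromov_hyperbolic_on (carrier G) (word_dist G X) \<delta>"
    and m: "real m > 2 * \<delta>"
    and w: "w \<in> words X" and loc: "every_factor (2 * m) (geodesic G X) w" and ne: "w \<noteq> []"
  shows "word_val G w \<noteq> \<one>"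
proof
  assume triv: "word_val G w = \<one>"
  have X: "X \<subseteq> carrier G"
    using gen by (auto simp: finite_generating_set_def)
  define p where "p i = word_val G (take i w)" for i
  define d where "d i j = word_dist G X (p i) (p j)" for i j
  define gp where "gp k i j = gromov_product (word_dist G X) (p k) (p i) (p j)" for k i j
  have tk: "take i w \<in> words X" "take j (drop i w) \<in> words X" for i j
    using w by (auto simp: words_def dest: in_set_takeD in_set_dropD)
  have p: "p i \<in> carrier G" for i
    unfolding p_def by (rule word_val_closed[OF X tk(1)])
  have sym: "d i j = d j i" for i j
    unfolding d_def by (rule word_dist_sym[OF gen p p])
  have gp_eq: "gp k i j = (d i k + d j k - d i j) / 2" for k i j
    by (simp add: gp_def gromov_product_def d_def)
  have d_pos: "d i j \<ge> 0" for i j by (simp add: d_def word_dist_def)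
  \<comment> \<open>local geodesicity enters only through this fact\<close>
  have d_near: "d i (i + j) = real j" if "i + j \<le> length w" "j \<le> 2 * m" for i j
  proof -
    let ?u = "take j (drop i w)"
    have "take (i + j) w = take i w @ ?u" by (rule take_add)
    then have "p (i + j) = p i \<otimes> word_val G ?u"
      unfolding p_def using word_val_append[OF X tk(1) tk(2)] by simp
    then have "inv (p i) \<otimes> p (i + j) = word_val G ?u"
      using p word_val_closed[OF X tk(2)] by (simp add: m_assoc[symmetric])
    moreover have "geodesic G X ?u"
      using loc that unfolding every_factor_def
      by (metis append_take_drop_id length_take min.coboundedI2 min.commute)
    moreover have "length ?u = j" using that by simp
    ultimately show ?thesis by (simp add: d_def word_dist_def geodesic_def)
  qed
  have hyp': "gp k i l \<ge> min (gp k i j) (gp k j l) - \<delta>" for k i j l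
    using hyp p unfolding gromov_hyperbolic_on_def gp_def by blast
  have delta: "\<delta> \<ge> 0"
    using hyp'[of 0 0 0 0] p[of 0] by (simp add: gp_eq d_def word_dist_def)
  have small: "gp n 0 (n + m) \<le> \<delta>" if "n + m \<le> length w" for n
    using that
  proof (induction n rule: less_induct)
    case (less n)
    show ?case
    proof (cases "n < m")
      case True
      then have "gp n 0 (n + m) = 0"
        using d_near[of 0 n] d_near[of n m] d_near[of 0 "n + m"] less.prems
          sym[of n 0] sym[of "n + m" n] by (simp add: gp_eq)
      then show ?thesis using delta by simp
    next
      case False
      define k where "k = n - m"
      have n: "n = k + m" using False by (simp add: k_def)
      have m0: "m > 0" using m delta by (cases m) auto
      have IH: "gp k 0 n \<le> \<delta>"
        using less.IH[of k] less.prems n m0 by simp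
      have "k + m \<le> length w" "n + m \<le> length w" "k + 2 * m \<le> length w"
        using less.prems n by auto
      then have km: "d k n = real m" and nm: "d n (n + m) = real m"
        and "d k (k + 2 * m) = 2 * real m"
        using d_near[of k m] d_near[of n m] d_near[of k "2 * m"] by (auto simp flip: n)
      moreover have "k + 2 * m = n + m" using n by simp
      ultimately have knm: "d k (n + m) = 2 * real m" by metis
      have "gp n k (n + m) = 0"
        unfolding gp_eq sym[of "n + m" n] km nm knm by simp
      moreover have "gp n k 0 = real m - gp k 0 n"
        unfolding gp_eq sym[of n k] sym[of k 0] sym[of n 0] km by (simp add: field_simps)
      ultimately show ?thesis
        \<comment> \<open>if the product at \<open>p n\<close> of \<open>p 0\<close> and \<open>p (n + m)\<close> exceeded \<open>\<delta>\<close>, both products in the minimum would\<close>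
        using hyp'[of n k 0 "n + m"] IH m by linarith
    qed
  qed
  have "d 0 (length w) = 0"
    using triv by (simp add: d_def word_dist_def p_def word_val_def[of G "[]"])
  moreover have "d 0 (length w) > 0"
  proof (cases "length w < m")
    case True
    then show ?thesis using d_near[of 0 "length w"] ne by simp
  next
    case False
    define n where "n = length w - m"
    have n: "length w = n + m" using False by (simp add: n_def)
    have "d 0 (length w) = d 0 n + real m - 2 * gp n 0 (n + m)"
      using d_near[of n m] n sym[of n 0] sym[of "n + m" n] by (simp add: gp_eq field_simps)
    then show ?thesis using small[of n] m n d_pos[of 0 n] by simp
  qed
  ultimately show False by simp
qed

end

section \<open>Machines with scripted actions\<close>

text \<open>An instruction says for each tape what to write and where to move, \<open>None\<close> meaning that the symbol
  under the head is kept.  A script is a list of instructions to be carried out blindly, that is,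
  without looking at the tapes in between.\<close>

type_synonym 'a instruction = "('a symbol option \<times> head_move) list"

definition resolve :: "'a symbol option \<times> head_move \<Rightarrow> 'a symbol \<Rightarrow> 'a symbol \<times> head_move" where
  "resolve a x = ((case fst a of None \<Rightarrow> x | Some y \<Rightarrow> y), snd a)"

definition act :: "'a symbol option \<times> head_move \<Rightarrow> 'a tape \<Rightarrow> 'a tape" where
  "act a t = tape_act (resolve a (tape_read t)) t"

definition perform :: "'a instruction \<Rightarrow> 'a tape list \<Rightarrow> 'a tape list" where
  "perform ins ts = map2 act ins ts"

definition script_step ::
  "('q \<Rightarrow> 'a symbol list \<Rightarrow> 'q \<times> 'a instruction list) \<Rightarrow> 'q \<times> 'a tape list \<Rightarrow> 'q \<times> 'a tape list"
where
  "script_step dec c =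
     (let (q, s) = dec (fst c) (map tape_read (snd c)) in (q, fold perform s (snd c)))"

lemma fst_script_step: "fst (script_step dec c) = fst (dec (fst c) (map tape_read (snd c)))"
  by (simp add: script_step_def split: prod.split)

text \<open>It is convenient to program a machine by a function that looks at the tapes and answers with a
  new control state and a whole script.  If the control states and the possible scripts are finite
  in number, this is a Turing machine again: its states are pairs of a control state and the rest
  of the script.  A step of the program costs one move for the decision and one for each
  instruction.\<close>

locale scripted_machine =
  fixes dec :: "'q \<Rightarrow> 'a symbol list \<Rightarrow> 'q \<times> 'a instruction list"
    and Q :: "'q set" and A :: "'a symbol set" and k L :: nat and q0 qa qr :: 'q
  assumes finite_Q: "finite Q" and finite_A: "finite A"
    and A: "{Blank, One, Minus_One} \<subseteq> A" and k: "2 \<le> k"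
    and states: "{q0, qa, qr} \<subseteq> Q" "qa \<noteq> qr"
    and dec_state: "q \<in> Q \<Longrightarrow> fst (dec q xs) \<in> Q"
    and dec_length: "q \<in> Q \<Longrightarrow> length (snd (dec q xs)) \<le> L"
    and dec_script: "q \<in> Q \<Longrightarrow> ins \<in> set (snd (dec q xs)) \<Longrightarrow>
          length ins = k \<and> fst ` set ins \<subseteq> insert None (Some ` A)"
begin

definition instructions :: "'a instruction set" where
  "instructions = {ins. set ins \<subseteq> insert None (Some ` A) \<times> UNIV \<and> length ins = k}"

definition control :: "('q \<times> 'a instruction list) set" where
  "control = Q \<times> {s. set s \<subseteq> instructions \<and> length s \<le> L}"

lemma finite_control: "finite control"
proof -
  have "finite (UNIV :: head_move set)"
  proof (rule finite_subset)
    show "UNIV \<subseteq> {Move_Left, Stay, Move_Right}"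
    proof
      fix x
      show "x \<in> {Move_Left, Stay, Move_Right}" by (cases x) simp_all
    qed
  qed simp
  then have "finite instructions"
    unfolding instructions_def using finite_A by (intro finite_lists_length_eq) auto
  then show ?thesis
    unfolding control_def by (rule finite_cartesian_product[OF finite_Q finite_lists_length_le])
qed

text \<open>The states of a Turing machine are natural numbers, so the pairs are numbered by some injection.\<close>

definition code :: "'q \<times> 'a instruction list \<Rightarrow> nat" where
  "code = (SOME f. inj_on f control)"

lemma inj_code: "inj_on code control"
proof -
  obtain f :: "'q \<times> 'a instruction list \<Rightarrow> nat" where "inj_on f control"
    using finite_imp_inj_to_nat_seg[OF finite_control] by (elim exE conjE)
  then show ?thesis unfolding code_def by (rule someI[of "\<lambda>f. inj_on f control" f])
qed

definition delta :: "nat \<Rightarrow> 'a symbol list \<Rightarrow> nat \<times> ('a symbol \<times> head_move) list" where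
  "delta i xs =
     (case the_inv_into control code i of
        \<comment> \<open>deciding takes a move of its own, which leaves the tapes unchanged\<close>
        (q, []) \<Rightarrow> (code (dec q xs), map (\<lambda>x. (x, Stay)) xs)
      | (q, ins # s) \<Rightarrow> (code (q, s), map2 resolve ins xs))"

definition machine :: "'a turing_machine" where
  "machine = \<lparr>tm_tapes = k, tm_states = code ` control, tm_alphabet = A,
     tm_start = code (q0, []), tm_accept = code (qa, []), tm_reject = code (qr, []),
     tm_delta = delta\<rparr>"

lemma machine_simps [simp]:
  "tm_tapes machine = k" "tm_states machine = code ` control" "tm_alphabet machine = A"
  "tm_start machine = code (q0, [])" "tm_accept machine = code (qa, [])"
  "tm_reject machine = code (qr, [])" "tm_delta machine = delta"
  by (simp_all add: machine_def)

lemma idle_in_control: "q \<in> Q \<Longrightarrow> (q, []) \<in> control"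
  by (simp add: control_def)

lemma dec_in_control: "q \<in> Q \<Longrightarrow> dec q xs \<in> control"
  using dec_state[of q xs] dec_length[of q xs] dec_script[of q _ xs]
  by (cases "dec q xs") (fastforce simp: control_def instructions_def)

lemma control_Cons:
  "(q, ins # s) \<in> control \<Longrightarrow> (q, s) \<in> control \<and> ins \<in> instructions"
  by (auto simp: control_def)

lemma delta_idle: "q \<in> Q \<Longrightarrow> delta (code (q, [])) xs = (code (dec q xs), map (\<lambda>x. (x, Stay)) xs)"
  by (simp add: delta_def the_inv_into_f_f[OF inj_code idle_in_control])

lemma delta_script:
  "(q, ins # s) \<in> control \<Longrightarrow> delta (code (q, ins # s)) xs = (code (q, s), map2 resolve ins xs)"
  by (simp add: delta_def the_inv_into_f_f[OF inj_code])

lemma resolve_symbols: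
  assumes "fst ` set ins \<subseteq> insert None (Some ` A)" "set xs \<subseteq> A"
  shows "fst ` set (map2 resolve ins xs) \<subseteq> A"
proof -
  have "fst (resolve a x) \<in> A" if "(a, x) \<in> set (zip ins xs)" for a x
  proof -
    have "fst a \<in> insert None (Some ` A)" "x \<in> A"
      using assms that by (auto dest: set_zip_leftD set_zip_rightD)
    then show ?thesis by (auto simp: resolve_def)
  qed
  then show ?thesis by auto
qed

lemma valid_machine: "valid_tm machine"
  unfolding valid_tm_def
proof (intro conjI ballI impI)
  show "tm_accept machine \<noteq> tm_reject machine"
    using states inj_on_eq_iff[OF inj_code idle_in_control idle_in_control, of qa qr]
    by (simp add: machine_def)
next
  fix i xs assume i: "i \<in> tm_states machine" and xs: "xs \<in> lists (tm_alphabet machine)"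
    and len: "length xs = tm_tapes machine"
  obtain q s where qs: "(q, s) \<in> control" "i = code (q, s)"
    using i by (auto simp: machine_def)
  have q: "q \<in> Q" using qs by (simp add: control_def)
  have xsA: "set xs \<subseteq> A" and k: "length xs = k" using xs len by (auto simp: machine_def)
  have "fst (delta i xs) \<in> code ` control \<and> length (snd (delta i xs)) = k \<and>
      fst ` set (snd (delta i xs)) \<subseteq> A"
  proof (cases s)
    case Nil
    have "delta i xs = (code (dec q xs), map (\<lambda>x. (x, Stay)) xs)"
      using delta_idle[OF q] qs Nil by simp
    then show ?thesis using dec_in_control[OF q, of xs] xsA k by auto
  next
    case (Cons ins s')
    have "delta i xs = (code (q, s'), map2 resolve ins xs)"
      using delta_script[of q ins s'] qs Cons by simp
    moreover have "length ins = k" "fst ` set ins \<subseteq> insert None (Some ` A)" "(q, s') \<in> control"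
      using control_Cons[of q ins s'] qs Cons by (auto simp: instructions_def)
    ultimately show ?thesis using resolve_symbols[of ins xs] xsA k by auto
  qed
  then show "fst (tm_delta machine i xs) \<in> tm_states machine"
    "length (snd (tm_delta machine i xs)) = tm_tapes machine"
    "fst ` set (snd (tm_delta machine i xs)) \<subseteq> tm_alphabet machine"
    by (simp_all add: machine_def)
qed (use k finite_A finite_control A states idle_in_control in \<open>auto simp: machine_def\<close>)

text \<open>The accepting and rejecting states have empty scripts, so that a script that leads to them is
  completed before the machine halts.\<close>

lemma halted_iff:
  "(q, s) \<in> control \<Longrightarrow> halted machine (code (q, s), ts) \<longleftrightarrow> q \<in> {qa, qr} \<and> s = []"
  using states idle_in_control inj_on_eq_iff[OF inj_code, of "(q, s)"]
  by (auto simp: halted_def machine_def)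

lemma map2_Stay: "map2 tape_act (map ((\<lambda>x. (x, Stay)) \<circ> tape_read) ts) ts = ts"
  by (induction ts) (auto simp: tape_act_def tape_read_def)

lemma map2_resolve:
  "map2 tape_act (map2 resolve ins (map tape_read ts)) ts = perform ins ts"
  unfolding perform_def
proof (induction ins arbitrary: ts)
  case (Cons a ins)
  then show ?case by (cases ts) (auto simp: act_def)
qed simp

lemma tm_step_idle:
  "q \<in> Q - {qa, qr} \<Longrightarrow>
     tm_step machine (code (q, []), ts) = (code (dec q (map tape_read ts)), ts)"
  using halted_iff[of q "[]" ts] idle_in_control delta_idle map2_Stay[of ts]
  by (auto simp: tm_step_def machine_def)

lemma tm_step_script:
  "(q, ins # s) \<in> control \<Longrightarrow>
     tm_step machine (code (q, ins # s), ts) = (code (q, s), perform ins ts)"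
  using halted_iff[of q "ins # s" ts] delta_script[of q ins s] map2_resolve[of ins ts]
  by (auto simp: tm_step_def machine_def)

lemma run_script:
  "(q, s) \<in> control \<Longrightarrow>
     (tm_step machine ^^ length s) (code (q, s), ts) = (code (q, []), fold perform s ts)"
proof (induction s arbitrary: ts)
  case (Cons ins s)
  then show ?case
    using control_Cons[of q ins s] tm_step_script[of q ins s] by (simp add: funpow_swap1)
qed simp

lemma simulate_step:
  assumes "fst c \<in> Q - {qa, qr}"
  shows "\<exists>t \<le> L + 1. (tm_step machine ^^ t) (code (fst c, []), snd c) =
           (code (fst (script_step dec c), []), snd (script_step dec c))"
proof -
  let ?d = "dec (fst c) (map tape_read (snd c))"
  have d: "(fst ?d, snd ?d) \<in> control" using dec_in_control assms by simp
  have "(tm_step machine ^^ Suc (length (snd ?d))) (code (fst c, []), snd c) =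
      (tm_step machine ^^ length (snd ?d)) (code (fst ?d, snd ?d), snd c)"
    using tm_step_idle[OF assms, of "snd c"] by (simp add: funpow_swap1)
  also have "\<dots> = (code (fst ?d, []), fold perform (snd ?d) (snd c))"
    by (rule run_script[OF d])
  also have "\<dots> = (code (fst (script_step dec c), []), snd (script_step dec c))"
    by (simp add: script_step_def split: prod.split)
  finally show ?thesis
    using dec_length[of "fst c"] assms by (intro exI[of _ "Suc (length (snd ?d))"]) auto
qed

theorem simulate:
  assumes "\<And>i. i < j \<Longrightarrow> fst ((script_step dec ^^ i) c) \<notin> {qa, qr}" "fst c \<in> Q"
  shows "\<exists>t \<le> (L + 1) * j. (tm_step machine ^^ t) (code (fst c, []), snd c) =
           (code (fst ((script_step dec ^^ j) c), []), snd ((script_step dec ^^ j) c))"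
  using assms
proof (induction j)
  case 0
  then show ?case by (intro exI[of _ 0]) simp
next
  case (Suc j)
  have inQ: "fst ((script_step dec ^^ i) c) \<in> Q" for i
  proof (induction i)
    case (Suc i)
    then show ?case using dec_state by (simp add: fst_script_step)
  qed (use Suc.prems in simp)
  obtain t where t: "t \<le> (L + 1) * j" "(tm_step machine ^^ t) (code (fst c, []), snd c) =
      (code (fst ((script_step dec ^^ j) c), []), snd ((script_step dec ^^ j) c))"
    using Suc by (metis less_SucI)
  obtain t' where t': "t' \<le> L + 1"
    "(tm_step machine ^^ t')
        (code (fst ((script_step dec ^^ j) c), []), snd ((script_step dec ^^ j) c)) =
      (code (fst ((script_step dec ^^ Suc j) c), []), snd ((script_step dec ^^ Suc j) c))"
    using simulate_step[of "(script_step dec ^^ j) c"] inQ[of j] Suc.prems(1)[of j] by auto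
  show ?case
    using t t' by (intro exI[of _ "t' + t"]) (simp add: funpow_add)
qed

end

section \<open>Tapes as stacks and counters\<close>

text \<open>The head is on the top of the stack, and the stack extends to the right.  What is left of the head
  is arbitrary; so popping is just a move to the right, and the input tape is a stack from the start.\<close>

definition stack_tape :: "'a symbol list \<Rightarrow> 'a tape \<Rightarrow> bool" where
  "stack_tape xs t \<longleftrightarrow>
     (\<forall>i. fst t (snd t + int i) = (if i < length xs then xs ! i else Blank))"

text \<open>The head is on the last symbol of the unary string, and left of the string if the string is empty.
  Thus the symbol under the head shows the sign of the counter.\<close>

definition counter_tape :: "int \<Rightarrow> 'a tape" where
  "counter_tape n = (tape_content (unary n), \<bar>n\<bar> - 1)"

lemma stack_tape_initial: "stack_tape xs (tape_content xs, 0)"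
  by (simp add: stack_tape_def tape_content_def)

lemma stack_tape_read:
  "stack_tape xs t \<Longrightarrow> tape_read t = (case xs of [] \<Rightarrow> Blank | x # _ \<Rightarrow> x)"
  unfolding stack_tape_def tape_read_def by (drule spec[of _ 0]) (auto split: list.split)

lemma act_None: "act (None, m) t = (fst t, move_head m (snd t))"
  by (simp add: act_def tape_act_def resolve_def tape_read_def)

lemma act_Some: "act (Some x, m) t = ((fst t)(snd t := x), move_head m (snd t))"
  by (simp add: act_def tape_act_def resolve_def)

definition pop :: "('a symbol option \<times> head_move) list" where
  "pop = [(None, Move_Right)]"

definition push_list :: "'a symbol list \<Rightarrow> ('a symbol option \<times> head_move) list" where
  "push_list xs = concat (map (\<lambda>x. [(None, Move_Left), (Some x, Stay)]) (rev xs))"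

text \<open>Here \<open>x\<close> is the symbol under the head of the counter, \<open>d\<close> is the unary symbol to be added and \<open>d'\<close> is
  the opposite one: the last \<open>d'\<close> cancels against \<open>d\<close> if there is one, and otherwise \<open>d\<close> is appended.\<close>

definition add_unary :: "'a symbol \<Rightarrow> 'a symbol \<Rightarrow> 'a symbol \<Rightarrow> ('a symbol option \<times> head_move) list" where
  "add_unary d d' x =
     (if x = d' then [(Some Blank, Move_Left)] else [(None, Move_Right), (Some d, Stay)])"

lemma stack_tape_pop:
  assumes "stack_tape (x # xs) t"
  shows "stack_tape xs (fold act pop t)"
  unfolding stack_tape_def
proof
  fix i
  have "fst t (snd t + (1 + int i)) = (if i < length xs then xs ! i else Blank)"
    using assms[unfolded stack_tape_def, rule_format, of "Suc i"] by simp
  then show "fst (fold act pop t) (snd (fold act pop t) + int i) =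
      (if i < length xs then xs ! i else Blank)"
    by (simp add: pop_def act_None add.assoc)
qed

lemma stack_tape_push:
  assumes "stack_tape xs t"
  shows "stack_tape (x # xs) (act (Some x, Stay) (act (None, Move_Left) t))"
    (is "stack_tape _ ?t'")
  unfolding stack_tape_def
proof
  fix i
  show "fst ?t' (snd ?t' + int i) = (if i < length (x # xs) then (x # xs) ! i else Blank)"
  proof (cases i)
    case 0
    then show ?thesis by (simp add: act_None act_Some)
  next
    case (Suc j)
    have "fst t (snd t + int j) = (if j < length xs then xs ! j else Blank)"
      using assms by (simp add: stack_tape_def)
    moreover have "snd t - 1 + int i = snd t + int j" using Suc by simp
    ultimately show ?thesis
      using Suc by (simp add: act_None act_Some)
  qed
qed

lemma stack_tape_push_list:
  "stack_tape ys t \<Longrightarrow> stack_tape (xs @ ys) (fold act (push_list xs) t)"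
proof (induction xs)
  case Nil
  then show ?case by (simp add: push_list_def)
next
  case (Cons x xs)
  have "fold act (push_list (x # xs)) t =
      act (Some x, Stay) (act (None, Move_Left) (fold act (push_list xs) t))"
    by (simp add: push_list_def)
  then show ?case using stack_tape_push[OF Cons.IH[OF Cons.prems], of x] by simp
qed

lemma tape_read_counter_tape:
  "tape_read (counter_tape n) = (if n = 0 then Blank else if 0 < n then One else Minus_One)"
  by (auto simp: tape_read_def counter_tape_def tape_content_def unary_def)

lemma counter_tape_initial: "act (None, Move_Left) (tape_content [], 0) = counter_tape 0"
  by (simp add: act_None counter_tape_def unary_def)

lemma tape_content_append:
  "int (length xs) = n \<Longrightarrow> (tape_content xs)(n := x) = tape_content (xs @ [x])"
  by (auto simp: fun_eq_iff tape_content_def nth_append nat_less_iff)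

lemma tape_content_erase:
  "int (length xs) = n \<Longrightarrow> (tape_content (xs @ [x]))(n := Blank) = tape_content xs"
  by (auto simp: fun_eq_iff tape_content_def nth_append nat_less_iff)

lemma unary_grow:
  assumes "0 \<le> n"
  shows "unary (n + 1) = unary n @ [One]" "unary (- n - 1) = unary (- n) @ [Minus_One]"
  using assms
  by (auto simp: unary_def nat_add_distrib replicate_append_same nat_diff_distrib')

lemma length_unary: "int (length (unary n)) = \<bar>n\<bar>"
  by (simp add: unary_def)

lemma counter_tape_grow:
  assumes "0 \<le> n"
  shows "act (Some One, Stay) (act (None, Move_Right) (counter_tape n)) = counter_tape (n + 1)"
    "act (Some Minus_One, Stay) (act (None, Move_Right) (counter_tape (- n))) =
       counter_tape (- n - 1)"
  using assms
  by (simp_all add: counter_tape_def act_None act_Some unary_grow tape_content_append length_unary)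

lemma counter_tape_shrink:
  assumes "0 \<le> n"
  shows "act (Some Blank, Move_Left) (counter_tape (n + 1)) = counter_tape n"
    "act (Some Blank, Move_Left) (counter_tape (- n - 1)) = counter_tape (- n)"
  using assms
  by (simp_all add: counter_tape_def act_Some unary_grow tape_content_erase length_unary)

lemma counter_up:
  "fold act (add_unary One Minus_One (tape_read (counter_tape n))) (counter_tape n) =
     counter_tape (n + 1)"
proof (cases "0 \<le> n")
  case True
  then show ?thesis
    by (simp add: add_unary_def tape_read_counter_tape counter_tape_grow(1))
next
  case False
  then show ?thesis
    using counter_tape_shrink(2)[of "- n - 1"]
    by (simp add: add_unary_def tape_read_counter_tape add.commute)
qed

lemma counter_down:
  "fold act (add_unary Minus_One One (tape_read (counter_tape n))) (counter_tape n) =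
     counter_tape (n - 1)"
proof (cases "n \<le> 0")
  case True
  then show ?thesis
    by (simp add: add_unary_def tape_read_counter_tape counter_tape_grow(2)[of "- n", simplified])
next
  case False
  then show ?thesis
    using counter_tape_shrink(1)[of "n - 1"] by (simp add: add_unary_def tape_read_counter_tape)
qed

abbreviation nop :: "'a symbol option \<times> head_move" where
  "nop \<equiv> (None, Stay)"

definition on_first :: "('a symbol option \<times> head_move) list \<Rightarrow> 'a instruction list" where
  "on_first as = map (\<lambda>a. [a, nop, nop]) as"

definition on_second :: "('a symbol option \<times> head_move) list \<Rightarrow> 'a instruction list" where
  "on_second as = map (\<lambda>a. [nop, a, nop]) as"

definition on_third :: "('a symbol option \<times> head_move) list \<Rightarrow> 'a instruction list" where
  "on_third as = map (\<lambda>a. [nop, nop, a]) as"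

lemma act_nop [simp]: "act nop t = t"
  by (simp add: act_None)

lemma perform_on_first: "fold perform (on_first as) [t1, t2, t3] = [fold act as t1, t2, t3]"
  by (induction as arbitrary: t1) (simp_all add: on_first_def perform_def)

lemma perform_on_second: "fold perform (on_second as) [t1, t2, t3] = [t1, fold act as t2, t3]"
  by (induction as arbitrary: t2) (simp_all add: on_second_def perform_def)

lemma perform_on_third: "fold perform (on_third as) [t1, t2, t3] = [t1, t2, fold act as t3]"
  by (induction as arbitrary: t3) (simp_all add: on_third_def perform_def)

lemma length_push_list [simp]: "length (push_list xs) = 2 * length xs"
  by (induction xs) (simp_all add: push_list_def)

lemma symbols_push_list:
  "set xs \<subseteq> D \<Longrightarrow> fst ` set (push_list xs) \<subseteq> insert None (Some ` D)"
  by (auto simp: push_list_def)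

section \<open>Dehn's algorithm with two stacks\<close>

datatype 'l control = Start | Run "'l list" int | Accept | Reject

text \<open>A state \<open>(B, c, n, S, P)\<close> of the algorithm consists of the buffer \<open>B\<close>, an integer \<open>c\<close> that has still
  to be added to the counter \<open>n\<close>, the stack \<open>S\<close>, and the pending input \<open>P\<close>.  The word processed so
  far is \<open>rev S @ B\<close>.  Pending letters are input letters or, once translated, letters of the stack.\<close>

type_synonym ('r, 'l) dehn_state = "'l list \<times> int \<times> int \<times> 'l list \<times> ('r + 'l) list"

text \<open>\<open>R\<close> is the input alphabet and \<open>A\<close> is the alphabet of the stack.  A translation of an input letter and
  a reduction of a word that is not irreducible are meant to be correct up to the central
  integer given by the respective offset.  The buffer holds up to \<open>b\<close> letters, so reductions are applied to words of
  length at most \<open>b + 1\<close>; \<open>N\<close> bounds the offsets and the lengths of the translations.\<close>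

locale dehn_algorithm =
  fixes R :: "'r set" and A :: "'l set" and b N :: nat
    and translate :: "'r \<Rightarrow> 'l list" and translate_offset :: "'r \<Rightarrow> int"
    and irreducible :: "'l list \<Rightarrow> bool"
    and reduce :: "'l list \<Rightarrow> 'l list" and reduce_offset :: "'l list \<Rightarrow> int"
  assumes finite_R: "finite R" and finite_A: "finite A" and b: "0 < b"
    and translate: "r \<in> R \<Longrightarrow> translate r \<in> lists A \<and> length (translate r) \<le> N \<and>
          \<bar>translate_offset r\<bar> \<le> int N"
    and reduce: "u \<in> lists A \<Longrightarrow> length u \<le> Suc b \<Longrightarrow> \<not> irreducible u \<Longrightarrow>
          reduce u \<in> lists A \<and> length (reduce u) < length u \<and> \<bar>reduce_offset u\<bar> \<le> int N"
    and irreducible_Nil: "irreducible []"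
    and irreducible_suffix: "p @ u \<in> lists A \<Longrightarrow> irreducible (p @ u) \<Longrightarrow> irreducible u"
begin

text \<open>The cases are, in this order: move the offset to the counter one by one, refill the buffer from the
  stack, translate the next input letter, and append the next translated letter to the buffer,
  from which the lowest letter passes to the stack if it was full.  If the
  buffer becomes reducible, its reduction is pushed back onto the pending input, because its
  letters may interact with the letters below.\<close>

fun dehn_step :: "('r, 'l) dehn_state \<Rightarrow> ('r, 'l) dehn_state" where
  "dehn_step (B, c, n, S, P) =
     (if 0 < c then (B, c - 1, n + 1, S, P)
      else if c < 0 then (B, c + 1, n - 1, S, P)
      else if length B < b \<and> S \<noteq> [] then (hd S # B, 0, n, tl S, P)
      else case P of
        [] \<Rightarrow> (B, c, n, S, P)
      | Inl r # P' \<Rightarrow> (B, translate_offset r, n, S, map Inr (translate r) @ P')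
      | Inr l # P' \<Rightarrow>
          (if irreducible (B @ [l]) then
             (if length B < b then (B @ [l], 0, n, S, P') else (tl B @ [l], 0, n, hd B # S, P'))
           else ([], reduce_offset (B @ [l]), n, S, map Inr (reduce (B @ [l])) @ P')))"

fun finished :: "('r, 'l) dehn_state \<Rightarrow> bool" where
  "finished (B, c, n, S, P) \<longleftrightarrow> c = 0 \<and> P = [] \<and> (b \<le> length B \<or> S = [])"

fun well_formed :: "('r, 'l) dehn_state \<Rightarrow> bool" where
  "well_formed (B, c, n, S, P) \<longleftrightarrow>
     B \<in> lists A \<and> length B \<le> b \<and> S \<in> lists A \<and> P \<in> lists (R <+> A)"

text \<open>The weights increase from the buffer over the stack to the pending letters by \<open>1\<close> each, which pays
  for moving a letter.  A reduction moves at most \<open>b\<close> letters of the buffer back to the pending input,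
  at the expense of \<open>2b\<close>, and creates an offset of at most \<open>N\<close>; this is paid for by the letter that gets
  lost, whose weight exceeds \<open>N + 2b\<close>.  An input letter pays for its translation and for its offset.\<close>

fun potential :: "('r, 'l) dehn_state \<Rightarrow> nat" where
  "potential (B, c, n, S, P) =
     nat \<bar>c\<bar> + (N + 2 * b + 1) * length B + (N + 2 * b + 2) * length S +
     sum_list (map (case_sum (\<lambda>_. 1 + N + (N + 2 * b + 3) * N) (\<lambda>_. N + 2 * b + 3)) P)"

lemma dehn_step_well_formed:
  assumes "well_formed s"
  shows "well_formed (dehn_step s)"
proof (cases s)
  case (fields B c n S P)
  show ?thesis
  proof (cases P)
    case Nil
    then show ?thesis using assms fields by (cases S) auto
  next
    case (Cons p P')
    have B: "B \<in> lists A" "length B \<le> b" using assms fields by auto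
    show ?thesis
    proof (cases p)
      case (Inl r)
      then show ?thesis using assms fields Cons translate[of r] by (cases S) auto
    next
      case (Inr l)
      then have "l \<in> A" using assms fields Cons by auto
      then show ?thesis
        using assms fields Cons Inr reduce[of "B @ [l]"] b by (cases S; cases B) auto
    qed
  qed
qed

lemma sum_list_map_Inr: "sum_list (map (case_sum f (\<lambda>_. k)) (map Inr xs)) = length xs * (k :: nat)"
  by (induction xs) simp_all

lemma dehn_step_potential:
  assumes "well_formed s" "\<not> finished s"
  shows "potential (dehn_step s) < potential s"
proof (cases s)
  case (fields B c n S P)
  consider "0 < c" | "c < 0" | "c = 0" "length B < b" "S \<noteq> []"
    | "c = 0" "\<not> (length B < b \<and> S \<noteq> [])" by linarith
  then show ?thesis
  proof cases
    case 3
    then obtain x S' where "S = x # S'" by (cases S) auto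
    then show ?thesis using fields 3 by simp
  next
    case 4
    then obtain p P' where P: "P = p # P'" using assms fields by (cases P) auto
    show ?thesis
    proof (cases p)
      case (Inl r)
      then have tr: "length (translate r) \<le> N" "\<bar>translate_offset r\<bar> \<le> int N"
        using assms fields P translate[of r] by auto
      have len: "length (translate r) * (N + 2 * b + 3) \<le> (N + 2 * b + 3) * N"
        using tr(1) by (simp add: mult.commute)
      have offset: "nat \<bar>translate_offset r\<bar> \<le> N" using tr(2) by simp
      have step: "dehn_step s =
          (B, translate_offset r, n, S, map Inr (translate r) @ P')"
        using 4 P Inl fields by simp
      have "potential (dehn_step s) < potential s \<longleftrightarrow>
          nat \<bar>translate_offset r\<bar> + length (translate r) * (N + 2 * b + 3)
            < 1 + N + (N + 2 * b + 3) * N"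
        unfolding step fields P Inl by (simp add: 4 sum_list_map_Inr del: map_map)
      then show ?thesis using offset len by linarith
    next
      case (Inr l)
      have B: "B \<in> lists A" "length B \<le> b" "l \<in> A"
        using assms fields P Inr by auto
      show ?thesis
      proof (cases "irreducible (B @ [l])")
        case True
        then show ?thesis using fields P Inr 4 b by (cases B) auto
      next
        case False
        let ?v = "reduce (B @ [l])"
        have v: "length ?v \<le> length B" "nat \<bar>reduce_offset (B @ [l])\<bar> \<le> N"
          using reduce[of "B @ [l]"] B False by auto
        have "length ?v * (N + 2 * b + 3) \<le> length B * (N + 2 * b + 1 + 2)"
          by (rule mult_le_mono[OF v(1)]) simp
        also have "\<dots> \<le> (N + 2 * b + 1) * length B + 2 * b"
          using B(2) by (simp add: algebra_simps)
        finally have "length ?v * (N + 2 * b + 3) \<le> (N + 2 * b + 1) * length B + 2 * b" .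
        moreover have step: "dehn_step s =
            ([], reduce_offset (B @ [l]), n, S, map Inr ?v @ P')"
          using 4 P Inr False fields by simp
        ultimately show ?thesis
          unfolding step fields P Inr using v(2) by (simp add: 4 sum_list_map_Inr del: map_map)
      qed
    qed
  qed (use fields in simp_all)
qed

lemma terminates:
  assumes "well_formed s"
  shows "\<exists>j \<le> potential s. finished ((dehn_step ^^ j) s) \<and> (\<forall>i < j. \<not> finished ((dehn_step ^^ i) s))"
  using assms
proof (induction "potential s" arbitrary: s rule: less_induct)
  case less
  show ?case
  proof (cases "finished s")
    case True
    then show ?thesis by (intro exI[of _ 0]) simp
  next
    case False
    have dec: "potential (dehn_step s) < potential s"
      by (rule dehn_step_potential[OF less.prems False])
    obtain j where j: "j \<le> potential (dehn_step s)" "finished ((dehn_step ^^ j) (dehn_step s))"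
        "\<forall>i < j. \<not> finished ((dehn_step ^^ i) (dehn_step s))"
      using less.hyps[OF dec dehn_step_well_formed[OF less.prems]] by blast
    have "\<not> finished ((dehn_step ^^ i) s)" if "i < Suc j" for i
      using that False j(3) by (cases i) (simp_all add: funpow_swap1)
    then show ?thesis
      using j dec by (intro exI[of _ "Suc j"]) (simp add: funpow_swap1)
  qed
qed

text \<open>A letter is appended only if the buffer with this letter is irreducible, and only if the buffer is
  full or is the whole word.  In both cases the buffer contains all new factors of length at most
  \<open>b + 1\<close>, by \<open>every_factor_snoc\<close>.\<close>

lemma dehn_step_every_factor:
  assumes wf: "well_formed (B, c, n, S, P)" and fac: "every_factor (Suc b) irreducible (rev S @ B)"
    and step: "dehn_step (B, c, n, S, P) = (B', c', n', S', P')"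
  shows "every_factor (Suc b) irreducible (rev S' @ B')"
proof -
  consider "c \<noteq> 0" | "c = 0" "length B < b" "S \<noteq> []"
    | "c = 0" "\<not> (length B < b \<and> S \<noteq> [])" by linarith
  then show ?thesis
  proof cases
    case 1
    then show ?thesis using fac step by (auto split: if_splits)
  next
    case 2
    then show ?thesis using fac step by (cases S) auto
  next
    case 3
    show ?thesis
    proof (cases P)
      case Nil
      then show ?thesis using fac step 3 by auto
    next
      case (Cons x P'')
      show ?thesis
      proof (cases x)
        case (Inl r)
        then show ?thesis using fac step 3 Cons by auto
      next
        case (Inr l)
        have l: "B @ [l] \<in> lists A" using wf Cons Inr by auto
        have snoc: "every_factor (Suc b) irreducible (rev S @ B @ [l])" if "irreducible (B @ [l])"
        proof (rule every_factor_snoc[OF fac])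
          show "irreducible v" if "B @ [l] = r @ v" for r v
            using irreducible_suffix[of r v] \<open>irreducible (B @ [l])\<close> l that by metis
          show "Suc b \<le> length B + 1 \<or> rev S = []" using 3 by auto
        qed
        show ?thesis
        proof (cases "irreducible (B @ [l])")
          case True
          then show ?thesis
            using snoc step 3 Cons Inr b by (cases B) (auto split: if_splits)
        next
          case False
          then show ?thesis
            using every_factor_prefix[OF fac] step 3 Cons Inr by auto
        qed
      qed
    qed
  qed
qed

section \<open>A Turing machine for Dehn's algorithm\<close>

definition letter_code :: "'l \<Rightarrow> nat" where
  "letter_code = (SOME f. inj_on f A)"

definition stack_symbol :: "'l \<Rightarrow> 'r symbol" where
  "stack_symbol l = Aux (letter_code l)"

definition stack_letter :: "'r symbol \<Rightarrow> 'l option" where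
  "stack_letter x = (if x \<in> stack_symbol ` A then Some (the_inv_into A stack_symbol x) else None)"

lemma inj_stack_symbol: "inj_on stack_symbol A"
proof -
  obtain f :: "'l \<Rightarrow> nat" where "inj_on f A"
    using finite_imp_inj_to_nat_seg[OF finite_A] by (elim exE conjE)
  then have "inj_on letter_code A"
    unfolding letter_code_def by (rule someI[of "\<lambda>f. inj_on f A" f])
  then show ?thesis by (simp add: inj_on_def stack_symbol_def)
qed

lemma stack_letter_simps [simp]:
  "l \<in> A \<Longrightarrow> stack_letter (stack_symbol l) = Some l"
  "stack_letter Blank = None" "stack_letter (Letter r) = None"
  using the_inv_into_f_f[OF inj_stack_symbol, of l]
  by (auto simp: stack_letter_def stack_symbol_def)

lemma stack_letter_SomeD: "stack_letter x = Some l \<Longrightarrow> l \<in> A"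
  using the_inv_into_into[OF inj_stack_symbol, of x A] by (auto simp: stack_letter_def split: if_splits)

text \<open>The program of the machine follows \<open>dehn_step\<close>; the pending input, the counter and the stack are on
  the first, second and third tape, and the remaining two components are in the control state.  The
  first step places the head of the counter.  A blank on the first tape ends the computation.
  A symbol on the first tape that does not belong there leads to a halting state, so that all scripts
  have bounded length.\<close>

definition decide :: "'l control \<Rightarrow> 'r symbol list \<Rightarrow> 'l control \<times> 'r instruction list" where
  "decide q xs =
     (case q of
        Start \<Rightarrow> (Run [] 0, on_second [(None, Move_Left)])
      | Accept \<Rightarrow> (Accept, [])
      | Reject \<Rightarrow> (Reject, [])
      | Run B c \<Rightarrow>
          if 0 < c then (Run B (c - 1), on_second (add_unary One Minus_One (xs ! 1)))
          else if c < 0 then (Run B (c + 1), on_second (add_unary Minus_One One (xs ! 1)))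
          else if length B < b \<and> stack_letter (xs ! 2) \<noteq> None then
            (Run (the (stack_letter (xs ! 2)) # B) 0, on_third pop)
          else case xs ! 0 of
            Letter r \<Rightarrow>
              if r \<in> R then
                (Run B (translate_offset r),
                 on_first (pop @ push_list (map stack_symbol (translate r))))
              else (Reject, [])
          | _ \<Rightarrow>
              (case stack_letter (xs ! 0) of
                 None \<Rightarrow> (if B = [] then Accept else Reject, [])
               | Some l \<Rightarrow>
                   if irreducible (B @ [l]) then
                     if length B < b then (Run (B @ [l]) 0, on_first pop)
                     else (Run (tl B @ [l]) 0,
                           on_first pop @ on_third (push_list [stack_symbol (hd B)]))
                   else
                     (Run [] (reduce_offset (B @ [l])),
                      on_first (pop @ push_list (map stack_symbol (reduce (B @ [l])))))))"

definition controls :: "'l control set" where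
  "controls = {Start, Accept, Reject} \<union>
     (\<lambda>(B, c). Run B c) ` ({B. set B \<subseteq> A \<and> length B \<le> b} \<times> {- int N..int N})"

definition alphabet :: "'r symbol set" where
  "alphabet = {Blank, One, Minus_One} \<union> Letter ` R \<union> stack_symbol ` A"

definition script_bound :: nat where
  "script_bound = 2 * (N + b) + 3"

text \<open>This is what a scripted machine requires of the answers of its program.\<close>

definition legal :: "'l control \<times> 'r instruction list \<Rightarrow> bool" where
  "legal d \<longleftrightarrow> fst d \<in> controls \<and> length (snd d) \<le> script_bound \<and>
     (\<forall>ins \<in> set (snd d). length ins = 3 \<and> fst ` set ins \<subseteq> insert None (Some ` alphabet))"

lemma legal_on:
  assumes "q \<in> controls" "length as \<le> 2 * (N + b) + 3"
    and as: "fst ` set as \<subseteq> insert None (Some ` alphabet)"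
  shows "legal (q, on_first as)" "legal (q, on_second as)" "legal (q, on_third as)"
proof -
  have "fst a \<in> insert None (Some ` alphabet)" if "a \<in> set as" for a
    using as that by blast
  then show "legal (q, on_first as)" "legal (q, on_second as)" "legal (q, on_third as)"
    using assms(1,2) by (simp_all add: legal_def script_bound_def on_first_def on_second_def on_third_def)
qed

lemma Run_in_controls:
  "set B \<subseteq> A \<Longrightarrow> length B \<le> b \<Longrightarrow> \<bar>c\<bar> \<le> int N \<Longrightarrow> Run B c \<in> controls"
  by (auto simp: controls_def intro!: image_eqI[of _ _ "(B, c)"])

lemma legal_Run_on_first:
  assumes "set B \<subseteq> A" "length B \<le> b" "\<bar>c\<bar> \<le> int N" "set xs \<subseteq> A" "length xs \<le> N + b"
  shows "legal (Run B c, on_first (pop @ push_list (map stack_symbol xs)))"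
proof (rule legal_on)
  have "set (map stack_symbol xs) \<subseteq> alphabet"
    using assms(4) by (auto simp: alphabet_def)
  then have "fst ` set (push_list (map stack_symbol xs)) \<subseteq> insert None (Some ` alphabet)"
    by (rule symbols_push_list)
  then show "fst ` set (pop @ push_list (map stack_symbol xs)) \<subseteq> insert None (Some ` alphabet)"
    by (simp add: pop_def image_Un)
qed (use assms Run_in_controls in \<open>simp_all add: pop_def\<close>)

lemma legal_decide:
  assumes q: "q \<in> controls"
  shows "legal (decide q xs)"
proof (cases q)
  case (Run B c)
  then have B: "set B \<subseteq> A" "length B \<le> b" and c: "\<bar>c\<bar> \<le> int N"
    using q by (auto simp: controls_def)
  have halt: "legal (Accept, [])" "legal (Reject, [])"
    by (simp_all add: legal_def controls_def)
  consider "c \<noteq> 0" | "c = 0" "length B < b \<and> stack_letter (xs ! 2) \<noteq> None"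
    | r where "c = 0" "\<not> (length B < b \<and> stack_letter (xs ! 2) \<noteq> None)" "xs ! 0 = Letter r"
    | "c = 0" "\<not> (length B < b \<and> stack_letter (xs ! 2) \<noteq> None)" "\<And>r. xs ! 0 \<noteq> Letter r"
    by blast
  then show ?thesis
  proof cases
    case 1
    have "legal (Run B c', on_second (add_unary d d' x))"
      if "\<bar>c'\<bar> \<le> int N" "d \<in> {One, Minus_One}" for c' d d' x
      using that by (intro legal_on Run_in_controls B) (auto simp: add_unary_def alphabet_def)
    then show ?thesis
      using Run 1 c by (simp add: decide_def)
  next
    case 2
    then obtain l where l: "stack_letter (xs ! 2) = Some l" by auto
    have "legal (Run (l # B) 0, on_third pop)"
      using B 2 stack_letter_SomeD[OF l] by (intro legal_on Run_in_controls) (auto simp: pop_def)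
    then show ?thesis
      using Run l 2 by (simp add: decide_def)
  next
    case 3
    then have "decide q xs = (if r \<in> R then (Run B (translate_offset r),
                 on_first (pop @ push_list (map stack_symbol (translate r)))) else (Reject, []))"
      using Run by (simp add: decide_def)
    then show ?thesis
      using translate[of r] B halt by (auto intro!: legal_Run_on_first)
  next
    case 4
    show ?thesis
    proof (cases "stack_letter (xs ! 0)")
      case None
      then have "decide q xs = (if B = [] then Accept else Reject, [])"
        using Run 4 by (auto simp: decide_def split: symbol.split)
      then show ?thesis using halt by simp
    next
      case (Some l)
      have d: "decide q xs =
         (if irreducible (B @ [l]) then
            if length B < b then (Run (B @ [l]) 0, on_first pop)
            else (Run (tl B @ [l]) 0, on_first pop @ on_third (push_list [stack_symbol (hd B)]))
          else
            (Run [] (reduce_offset (B @ [l])),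
             on_first (pop @ push_list (map stack_symbol (reduce (B @ [l]))))))"
        using Run 4 Some by (auto simp: decide_def split: symbol.split)
      have l: "l \<in> A" by (rule stack_letter_SomeD[OF Some])
      have pop: "legal (Run (B @ [l]) 0, on_first pop)" if "length B < b"
        using legal_Run_on_first[of "B @ [l]" 0 "[]"] B l that by (simp add: push_list_def)
      have push: "legal (Run (tl B @ [l]) 0,
          on_first pop @ on_third (push_list [stack_symbol (hd B)]))" if "\<not> length B < b"
      proof -
        have "B \<noteq> []" using that b by auto
        then obtain x B' where B': "B = x # B'" by (cases B) auto
        then have "legal (Run (tl B @ [l]) 0, on_first pop)"
          "legal (Run (tl B @ [l]) 0, on_third (push_list [stack_symbol (hd B)]))"
          using B l by (auto simp: pop_def push_list_def alphabet_def intro!: legal_on Run_in_controls)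
        then show ?thesis
          by (auto simp: legal_def script_bound_def on_first_def on_third_def pop_def push_list_def)
      qed
      have "legal (Run [] (reduce_offset (B @ [l])),
          on_first (pop @ push_list (map stack_symbol (reduce (B @ [l])))))"
        if "\<not> irreducible (B @ [l])"
      proof -
        have "B @ [l] \<in> lists A" "length (B @ [l]) \<le> Suc b" using B l by auto
        then have "reduce (B @ [l]) \<in> lists A" "length (reduce (B @ [l])) < length (B @ [l])"
          "\<bar>reduce_offset (B @ [l])\<bar> \<le> int N"
          using reduce[of "B @ [l]"] that by auto
        then show ?thesis using B(2) by (intro legal_Run_on_first) auto
      qed
      then show ?thesis using d pop push by simp
    qed
  qed
qed (auto simp: decide_def controls_def legal_def[of "(_, [])"] b intro!: legal_on Run_in_controls)

sublocale scripted_machine decide controls alphabet 3 script_bound Start Accept Reject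
proof
  have "finite {B. set B \<subseteq> A \<and> length B \<le> b}" by (rule finite_lists_length_le[OF finite_A])
  then show "finite controls" unfolding controls_def by simp
  show "finite alphabet" using finite_R finite_A by (simp add: alphabet_def)
  show "fst (decide q xs) \<in> controls" "length (snd (decide q xs)) \<le> script_bound"
    if "q \<in> controls" for q xs
    using legal_decide[OF that] by (simp_all add: legal_def)
  show "length ins = 3 \<and> fst ` set ins \<subseteq> insert None (Some ` alphabet)"
    if "q \<in> controls" "ins \<in> set (snd (decide q xs))" for q ins xs
    using legal_decide[OF that(1)] that(2) by (simp add: legal_def)
qed (auto simp: alphabet_def controls_def)

fun represents :: "('r, 'l) dehn_state \<Rightarrow> 'l control \<times> 'r tape list \<Rightarrow> bool" where
  "represents (B, c, n, S, P) C \<longleftrightarrow>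
     (\<exists>t1 t3. C = (Run B c, [t1, counter_tape n, t3]) \<and>
        stack_tape (map (case_sum Letter stack_symbol) P) t1 \<and>
        stack_tape (map stack_symbol S) t3)"

lemma script_step_Run:
  "script_step decide (Run B c, [t1, t2, t3]) =
     (let (q, s) = decide (Run B c) [tape_read t1, tape_read t2, tape_read t3]
      in (q, fold perform s [t1, t2, t3]))"
  by (simp add: script_step_def)

lemmas perform_simps = perform_on_first perform_on_second perform_on_third fold_append

lemma represents_initial:
  "represents ([], 0, 0, [], map Inl w)
     (script_step decide (Start, snd (initial_config machine w)))"
proof -
  have "replicate (3 - 1) x = [x, x]" for x :: "'r tape"
    by (simp add: numeral_2_eq_2)
  then have "snd (initial_config machine w) =
      [(tape_content (map Letter w), 0), (tape_content [], 0), (tape_content [], 0)]"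
    by (simp add: initial_config_def)
  then show ?thesis
    using stack_tape_initial[of "map Letter w"] stack_tape_initial[of "[]"]
    by (simp add: script_step_def decide_def perform_on_second counter_tape_initial comp_def
        del: split_paired_Ex)
qed

lemma read_third:
  assumes "stack_tape (map stack_symbol S) t" "S \<in> lists A"
  shows "stack_letter (tape_read t) = (case S of [] \<Rightarrow> None | l # _ \<Rightarrow> Some l)"
  using stack_tape_read[OF assms(1)] assms(2) by (cases S) auto

lemma represents_step:
  assumes wf: "well_formed s" and rep: "represents s C" and nfin: "\<not> finished s"
  shows "represents (dehn_step s) (script_step decide C)"
proof (cases s)
  case (fields B c n S P)
  obtain t1 t3 where C: "C = (Run B c, [t1, counter_tape n, t3])"
    and t1: "stack_tape (map (case_sum Letter stack_symbol) P) t1"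
    and t3: "stack_tape (map stack_symbol S) t3"
    using rep fields by auto
  have wf': "B \<in> lists A" "S \<in> lists A" "P \<in> lists (R <+> A)" using wf fields by auto
  have r3: "stack_letter (tape_read t3) = (case S of [] \<Rightarrow> None | l # _ \<Rightarrow> Some l)"
    by (rule read_third[OF t3 wf'(2)])
  consider "0 < c" | "c < 0" | "c = 0" "length B < b" "S \<noteq> []"
    | "c = 0" "\<not> (length B < b \<and> S \<noteq> [])" by linarith
  then show ?thesis
  proof cases
    case 1
    then show ?thesis
      using fields C t1 t3 by (simp add: script_step_Run decide_def perform_simps counter_up del: split_paired_Ex)
  next
    case 2
    then show ?thesis
      using fields C t1 t3 by (simp add: script_step_Run decide_def perform_simps counter_down del: split_paired_Ex)
  next
    case 3
    then obtain l S' where S: "S = l # S'" by (cases S) auto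
    then show ?thesis
      using 3 fields C t1 t3 r3 stack_tape_pop[of "stack_symbol l" "map stack_symbol S'" t3]
      by (simp add: script_step_Run decide_def perform_simps del: split_paired_Ex)
  next
    case 4
    have nb: "\<not> (length B < b \<and> stack_letter (tape_read t3) \<noteq> None)"
      using 4 r3 by (auto split: list.splits)
    obtain p P' where P: "P = p # P'" using 4 nfin fields by (cases P) auto
    have pop: "stack_tape (map (case_sum Letter stack_symbol) P') (fold act pop t1)"
      using t1 P by (intro stack_tape_pop) simp
    have push: "stack_tape (map (case_sum Letter stack_symbol) (map Inr v @ P'))
        (fold act (push_list (map stack_symbol v)) (fold act pop t1))" for v
      using stack_tape_push_list[OF pop, of "map stack_symbol v"] by (simp add: comp_def)
    show ?thesis
    proof (cases p)
      case (Inl r)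
      then have "r \<in> R" "tape_read t1 = Letter r"
        using wf' P stack_tape_read[OF t1] by auto
      then show ?thesis
        using 4 nb fields C P Inl t3 push[of "translate r"]
        by (simp add: script_step_Run decide_def perform_simps del: split_paired_Ex)
    next
      case (Inr l)
      then have l: "l \<in> A" and r1: "tape_read t1 = stack_symbol l"
        using wf' P stack_tape_read[OF t1] by auto
      have d: "decide (Run B c) [tape_read t1, tape_read (counter_tape n), tape_read t3] =
         (if irreducible (B @ [l]) then
            if length B < b then (Run (B @ [l]) 0, on_first pop)
            else (Run (tl B @ [l]) 0, on_first pop @ on_third (push_list [stack_symbol (hd B)]))
          else
            (Run [] (reduce_offset (B @ [l])),
             on_first (pop @ push_list (map stack_symbol (reduce (B @ [l]))))))"
        using 4 nb r1 l stack_letter_simps(1)[OF l]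
        by (cases "length B < b") (simp_all add: decide_def stack_symbol_def)
      have push3: "stack_tape (map stack_symbol (hd B # S))
          (fold act (push_list [stack_symbol (hd B)]) t3)"
        using stack_tape_push_list[OF t3, of "[stack_symbol (hd B)]"] by simp
      have empty3: "stack_tape [] t3" if "length B < b"
        using that t3 4 by auto
      show ?thesis
        unfolding fields C script_step_Run d
        using 4 P Inr t3 empty3 pop push[of "reduce (B @ [l])"] push3
        by (simp add: perform_simps del: split_paired_Ex)
    qed
  qed
qed

text \<open>If the input is used up and the buffer is not full, the stack is empty.  Hence the finite control
  can tell from the buffer alone whether the whole word is empty, as \<open>b > 0\<close>.\<close>

lemma represents_finished:
  assumes "well_formed (B, c, n, S, P)" "represents (B, c, n, S, P) C" "finished (B, c, n, S, P)"
  shows "fst (script_step decide C) = (if B = [] then Accept else Reject) \<and>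
    snd (script_step decide C) ! 1 = counter_tape n"
proof -
  obtain t1 t3 where C: "C = (Run B c, [t1, counter_tape n, t3])"
    and t1: "stack_tape (map (case_sum Letter stack_symbol) P) t1"
    and t3: "stack_tape (map stack_symbol S) t3"
    using assms by auto
  have "S \<in> lists A" using assms by auto
  then have r3: "stack_letter (tape_read t3) = (case S of [] \<Rightarrow> None | l # _ \<Rightarrow> Some l)"
    by (rule read_third[OF t3])
  have "tape_read t1 = Blank" using assms(3) stack_tape_read[OF t1] by simp
  then show ?thesis
    using assms(3) C r3 by (auto simp: script_step_Run decide_def)
qed

theorem implementation:
  "\<exists>(M :: 'r turing_machine) a k. valid_tm M \<and> Letter ` R \<subseteq> tm_alphabet M \<and>
     (\<forall>w \<in> lists R. \<exists>t \<le> a * length w + k. \<exists>j B n S.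
        (dehn_step ^^ j) ([], 0, 0, [], map Inl w) = (B, 0, n, S, []) \<and>
        (b \<le> length B \<or> S = []) \<and>
        fst (config_after M w t) = (if B = [] then tm_accept M else tm_reject M) \<and>
        output_tape (config_after M w t) = tape_content (unary n))"
proof -
  define L where "L = script_bound + 1"
  define W where "W = 1 + N + (N + 2 * b + 3) * N"
  have main: "\<exists>t \<le> (L * W) * length w + 2 * L. \<exists>j B n S.
      (dehn_step ^^ j) ([], 0, 0, [], map Inl w) = (B, 0, n, S, []) \<and>
      (b \<le> length B \<or> S = []) \<and>
      fst (config_after machine w t) = (if B = [] then tm_accept machine else tm_reject machine) \<and>
      output_tape (config_after machine w t) = tape_content (unary n)"
    if w: "w \<in> lists R" for w
  proof -
    let ?s = "([], 0, 0, [], map Inl w) :: ('r, 'l) dehn_state"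
    let ?C = "(Start, snd (initial_config machine w))"
    have wf: "well_formed ?s" using w by auto
    have wf_j: "well_formed ((dehn_step ^^ j) ?s)" for j
      by (induction j) (simp_all add: wf dehn_step_well_formed del: well_formed.simps)
    have pot: "potential ?s = W * length w"
      by (induction w) (simp_all add: W_def)
    obtain j where j: "j \<le> W * length w" "finished ((dehn_step ^^ j) ?s)"
        "\<And>i. i < j \<Longrightarrow> \<not> finished ((dehn_step ^^ i) ?s)"
      using terminates[OF wf] pot by auto
    have rep: "represents ((dehn_step ^^ i) ?s) ((script_step decide ^^ Suc i) ?C)" if "i \<le> j" for i
      using that
    proof (induction i)
      case 0
      then show ?case using represents_initial[of w] by simp
    next
      case (Suc i)
      then show ?case
        using represents_step[OF wf_j, of i "(script_step decide ^^ Suc i) ?C"] j(3)[of i] by simp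
    qed
    obtain B c n S P where s: "(dehn_step ^^ j) ?s = (B, c, n, S, P)" by (metis prod_cases5)
    have fin: "c = 0" "P = []" "b \<le> length B \<or> S = []" using j(2) s by auto
    have result: "fst ((script_step decide ^^ Suc (Suc j)) ?C) = (if B = [] then Accept else Reject)"
      "snd ((script_step decide ^^ Suc (Suc j)) ?C) ! 1 = counter_tape n"
      using represents_finished[of B c n S P "(script_step decide ^^ Suc j) ?C"]
        wf_j[of j] rep[of j] j(2) s by simp_all
    \<comment> \<open>one step for the start, one for each step of the algorithm, and one for halting\<close>
    have "fst ((script_step decide ^^ i) ?C) \<notin> {Accept, Reject}" if "i < Suc (Suc j)" for i
    proof (cases i)
      case (Suc i')
      then show ?thesis
        using rep[of i'] that by (cases "(dehn_step ^^ i') ?s") auto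
    qed simp
    then obtain t where t: "t \<le> L * Suc (Suc j)"
      "(tm_step machine ^^ t) (code (Start, []), snd (initial_config machine w)) =
       (code (fst ((script_step decide ^^ Suc (Suc j)) ?C), []),
        snd ((script_step decide ^^ Suc (Suc j)) ?C))"
      using simulate[of "Suc (Suc j)" ?C] states by (auto simp: L_def)
    have "config_after machine w t =
       (code (fst ((script_step decide ^^ Suc (Suc j)) ?C), []),
        snd ((script_step decide ^^ Suc (Suc j)) ?C))"
      using t(2) by (simp add: config_after_def initial_config_def)
    then have "fst (config_after machine w t) = (if B = [] then tm_accept machine else tm_reject machine)"
      "output_tape (config_after machine w t) = tape_content (unary n)"
      using result by (simp_all add: output_tape_def counter_tape_def)
    moreover have "t \<le> (L * W) * length w + 2 * L"
    proof -
      note t(1)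
      also have "L * Suc (Suc j) \<le> L * (W * length w + 2)"
        using j(1) by (intro mult_le_mono2) simp
      also have "\<dots> = (L * W) * length w + 2 * L" by (simp add: algebra_simps)
      finally show ?thesis .
    qed
    ultimately show ?thesis using s fin by blast
  qed
  moreover have "Letter ` R \<subseteq> tm_alphabet machine"
    unfolding machine_simps by (auto simp: alphabet_def)
  ultimately show ?thesis using valid_machine by blast
qed

end

section \<open>Values in a central extension\<close>

text \<open>The offsets now become exponents of the central subgroup \<open>range \<iota>\<close>: translations and reductions hold in
  \<open>G\<close> up to the central elements that they announce.\<close>

locale central_dehn_algorithm = dehn_algorithm R A b N translate translate_offset irreducible reduce reduce_offset
    + group G
  for R :: "'r set" and A :: "'l set" and b N translate translate_offset irreducible reduce
    and reduce_offset and G (structure) +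
  fixes \<iota> :: "int \<Rightarrow> 'g" and letter :: "'r \<Rightarrow> 'g" and lift :: "'l \<Rightarrow> 'g"
  assumes iota: "\<iota> \<in> hom integer_group G"
    and central: "g \<in> carrier G \<Longrightarrow> \<iota> k \<otimes> g = g \<otimes> \<iota> k"
    and letter_closed: "r \<in> R \<Longrightarrow> letter r \<in> carrier G"
    and lift_closed: "l \<in> A \<Longrightarrow> lift l \<in> carrier G"
    and translate_val: "r \<in> R \<Longrightarrow>
      letter r = \<iota> (translate_offset r) \<otimes> list_prod G lift (translate r)"
    and reduce_val: "u \<in> lists A \<Longrightarrow> length u \<le> Suc b \<Longrightarrow> \<not> irreducible u \<Longrightarrow>
      list_prod G lift u = \<iota> (reduce_offset u) \<otimes> list_prod G lift (reduce u)"
begin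

lemma iota_closed [simp]: "\<iota> k \<in> carrier G"
  using iota by (auto simp: hom_def)

lemma iota_add: "g \<in> carrier G \<Longrightarrow> \<iota> j \<otimes> (\<iota> k \<otimes> g) = \<iota> (j + k) \<otimes> g"
  using iota by (simp add: hom_def m_assoc[symmetric])

lemma iota_commute:
  "g \<in> carrier G \<Longrightarrow> h \<in> carrier G \<Longrightarrow> g \<otimes> (\<iota> k \<otimes> h) = \<iota> k \<otimes> (g \<otimes> h)"
  using central[of g k] by (simp add: m_assoc[symmetric])

lemma lift_word_closed: "u \<in> lists A \<Longrightarrow> list_prod G lift u \<in> carrier G"
  using lift_closed by (intro list_prod_closed) auto

lemma lift_word_append:
  "u \<in> lists A \<Longrightarrow> v \<in> lists A \<Longrightarrow>
     list_prod G lift (u @ v) = list_prod G lift u \<otimes> list_prod G lift v"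
  using lift_closed by (intro list_prod_append) auto

abbreviation pending_val :: "('r + 'l) list \<Rightarrow> 'g" where
  "pending_val \<equiv> list_prod G (case_sum letter lift)"

lemma pending_closed: "P \<in> lists (R <+> A) \<Longrightarrow> pending_val P \<in> carrier G"
  using lift_closed letter_closed by (intro list_prod_closed) auto

lemma pending_append:
  assumes "v \<in> lists A" "P \<in> lists (R <+> A)"
  shows "pending_val (map Inr v @ P) = list_prod G lift v \<otimes> pending_val P"
proof -
  have "pending_val (map Inr v @ P) = pending_val (map Inr v) \<otimes> pending_val P"
    using assms lift_closed letter_closed by (intro list_prod_append) auto
  then show ?thesis by (simp add: list_prod_map comp_def)
qed

text \<open>The element of \<open>G\<close> that a state stands for; it is an invariant of the algorithm because the offsets are
  central and can be moved to the front.\<close>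

fun state_val :: "('r, 'l) dehn_state \<Rightarrow> 'g" where
  "state_val (B, c, n, S, P) =
     \<iota> (n + c) \<otimes> (list_prod G lift (rev S @ B) \<otimes> pending_val P)"

lemma dehn_step_state_val:
  assumes wf: "well_formed s"
  shows "state_val (dehn_step s) = state_val s"
proof (cases s)
  case (fields B c n S P)
  have B: "B \<in> lists A" "length B \<le> b" and S: "rev S \<in> lists A" and P: "P \<in> lists (R <+> A)"
    using wf fields by auto
  let ?g = "list_prod G lift (rev S @ B)"
  have g: "?g \<in> carrier G" using B S by (intro lift_word_closed) auto
  consider "c \<noteq> 0" | "c = 0" "length B < b" "S \<noteq> []"
    | "c = 0" "\<not> (length B < b \<and> S \<noteq> [])" by linarith
  then show ?thesis
  proof cases
    case 1
    then show ?thesis using fields by simp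
  next
    case 2
    then show ?thesis using fields by (cases S) auto
  next
    case 3
    show ?thesis
    proof (cases P)
      case Nil
      then show ?thesis using fields 3 by auto
    next
      case (Cons x P')
      have P': "P' \<in> lists (R <+> A)" using P Cons by auto
      note p = pending_closed[OF P']
      show ?thesis
      proof (cases x)
        case (Inl r)
        then have r: "r \<in> R" using P Cons by auto
        let ?v = "list_prod G lift (translate r)" and ?k = "translate_offset r"
        have v: "?v \<in> carrier G" using translate[OF r] by (intro lift_word_closed) auto
        have step: "dehn_step s = (B, ?k, n, S, map Inr (translate r) @ P')"
          using fields 3 Cons Inl by simp
        have "state_val s = \<iota> n \<otimes> (?g \<otimes> (\<iota> ?k \<otimes> ?v \<otimes> pending_val P'))"
          using fields 3 Cons Inl translate_val[OF r] by simp
        also have "\<dots> = \<iota> n \<otimes> (?g \<otimes> (\<iota> ?k \<otimes> (?v \<otimes> pending_val P')))"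
          using v p by (simp add: m_assoc)
        also have "\<dots> = \<iota> (n + ?k) \<otimes> (?g \<otimes> (?v \<otimes> pending_val P'))"
          by (simp only: iota_commute[OF g m_closed[OF v p]] iota_add[OF m_closed[OF g m_closed[OF v p]]])
        also have "\<dots> = state_val (dehn_step s)"
          unfolding step using translate[OF r] by (simp add: pending_append[OF _ P'])
        finally show ?thesis by simp
      next
        case (Inr l)
        then have l: "l \<in> A" using P Cons by auto
        have Bl: "B @ [l] \<in> lists A" "length (B @ [l]) \<le> Suc b" using B l by auto
        have "list_prod G lift (rev S @ B @ [l]) = ?g \<otimes> lift l"
          using lift_word_append[of "rev S @ B" "[l]"] B S l lift_closed[OF l] by simp
        then have val: "state_val s = \<iota> n \<otimes> (list_prod G lift (rev S @ B @ [l]) \<otimes> pending_val P')"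
          using fields 3 Cons Inr g p lift_closed[OF l] by (simp add: m_assoc)
        show ?thesis
        proof (cases "irreducible (B @ [l])")
          case True
          show ?thesis
          proof (cases "length B < b")
            case True
            then have "dehn_step s = (B @ [l], 0, n, S, P')"
              using fields 3 Cons Inr \<open>irreducible (B @ [l])\<close> by simp
            then show ?thesis using val by simp
          next
            case False
            obtain y B' where B': "B = y # B'" using False b by (cases B) auto
            have "dehn_step s = (B' @ [l], 0, n, y # S, P')"
              using fields 3 Cons Inr \<open>irreducible (B @ [l])\<close> False B' by simp
            then show ?thesis using val B' by simp
          qed
        next
          case False
          let ?v = "list_prod G lift (reduce (B @ [l]))" and ?k = "reduce_offset (B @ [l])"
          let ?h = "list_prod G lift (rev S)"
          have step: "dehn_step s = ([], ?k, n, S, map Inr (reduce (B @ [l])) @ P')"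
            using fields 3 Cons Inr False by simp
          have red: "reduce (B @ [l]) \<in> lists A" using reduce[OF Bl False] by simp
          have v: "?v \<in> carrier G" and h: "?h \<in> carrier G"
            using lift_word_closed[OF red] lift_word_closed[OF S] by auto
          have "list_prod G lift (rev S @ B @ [l]) = ?h \<otimes> (\<iota> ?k \<otimes> ?v)"
            using lift_word_append[OF S Bl(1)] reduce_val[OF Bl False] by simp
          then have "state_val s = \<iota> n \<otimes> (?h \<otimes> (\<iota> ?k \<otimes> ?v) \<otimes> pending_val P')"
            using val by simp
          also have "\<dots> = \<iota> n \<otimes> (\<iota> ?k \<otimes> (?h \<otimes> (?v \<otimes> pending_val P')))"
            using h v p by (simp add: iota_commute[OF h v] m_assoc)
          also have "\<dots> = \<iota> (n + ?k) \<otimes> (?h \<otimes> (?v \<otimes> pending_val P'))"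
            using h v p by (simp add: iota_add)
          also have "\<dots> = state_val (dehn_step s)"
            unfolding step by (simp add: pending_append[OF red P'])
          finally show ?thesis by simp
        qed
      qed
    qed
  qed
qed

lemma dehn_run:
  assumes w: "w \<in> lists R"
    and run: "(dehn_step ^^ j) ([], 0, 0, [], map Inl w) = (B, 0, n, S, [])"
  shows "rev S @ B \<in> lists A" "every_factor (Suc b) irreducible (rev S @ B)"
    "list_prod G letter w = \<iota> n \<otimes> list_prod G lift (rev S @ B)"
proof -
  let ?s = "([], 0, 0, [], map Inl w) :: ('r, 'l) dehn_state"
  have wf: "well_formed ((dehn_step ^^ j) ?s)" for j
    using w by (induction j) (auto simp: dehn_step_well_formed simp del: dehn_step.simps)
  have "well_formed (B, 0, n, S, [])" using wf[of j] unfolding run .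
  then show A: "rev S @ B \<in> lists A" by auto
  have "(dehn_step ^^ j) ?s = (B, c, n, S, P) \<Longrightarrow> every_factor (Suc b) irreducible (rev S @ B)"
    for j B c n S P
  proof (induction j arbitrary: B c n S P)
    case 0
    then show ?case using irreducible_Nil by (auto simp: every_factor_def)
  next
    case (Suc j)
    obtain B0 c0 n0 S0 P0 where s: "(dehn_step ^^ j) ?s = (B0, c0, n0, S0, P0)"
      by (metis prod_cases5)
    have "well_formed (B0, c0, n0, S0, P0)" using wf[of j] unfolding s .
    moreover have "dehn_step (B0, c0, n0, S0, P0) = (B, c, n, S, P)" using Suc.prems s by simp
    ultimately show ?case using dehn_step_every_factor[OF _ Suc.IH[OF s]] by blast
  qed
  from this[OF run] show "every_factor (Suc b) irreducible (rev S @ B)" .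
  have "state_val ((dehn_step ^^ j) ?s) = state_val ?s"
    by (induction j) (simp_all add: dehn_step_state_val[OF wf] del: dehn_step.simps state_val.simps)
  then have "\<iota> n \<otimes> list_prod G lift (rev S @ B) = \<iota> 0 \<otimes> list_prod G letter w"
    using run lift_word_closed[OF A] list_prod_closed[of w letter] letter_closed w
    by (auto simp: list_prod_map comp_def)
  moreover have "\<iota> 0 = \<one>"
    using hom_one[OF iota group_integer_group is_group] by simp
  moreover have "list_prod G letter w \<in> carrier G"
    using letter_closed w by (intro list_prod_closed) auto
  ultimately show "list_prod G letter w = \<iota> n \<otimes> list_prod G lift (rev S @ B)" by simp
qed

text \<open>If \<open>u\<close> is empty, then \<open>n\<close> is the answer.  If nonempty words whose short factors are all irreducible
  are nontrivial modulo \<open>range \<iota>\<close>, as in hyperbolic groups, then the machine moreover rejects precisely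
  the words with values outside \<open>range \<iota>\<close>.\<close>

theorem machine_reduces_input:
  "\<exists>(M :: 'r turing_machine) a k. valid_tm M \<and> Letter ` R \<subseteq> tm_alphabet M \<and>
     (\<forall>w \<in> lists R. \<exists>t \<le> a * length w + k. \<exists>n u.
        u \<in> lists A \<and> every_factor (Suc b) irreducible u \<and>
        list_prod G letter w = \<iota> n \<otimes> list_prod G lift u \<and>
        fst (config_after M w t) = (if u = [] then tm_accept M else tm_reject M) \<and>
        output_tape (config_after M w t) = tape_content (unary n))"
proof -
  obtain M :: "'r turing_machine" and a k where M: "valid_tm M" "Letter ` R \<subseteq> tm_alphabet M"
    and run: "\<forall>w \<in> lists R. \<exists>t \<le> a * length w + k. \<exists>j B n S.
        (dehn_step ^^ j) ([], 0, 0, [], map Inl w) = (B, 0, n, S, []) \<and>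
        (b \<le> length B \<or> S = []) \<and>
        fst (config_after M w t) = (if B = [] then tm_accept M else tm_reject M) \<and>
        output_tape (config_after M w t) = tape_content (unary n)"
    using implementation by (elim exE conjE)
  have "\<exists>t \<le> a * length w + k. \<exists>n u.
        u \<in> lists A \<and> every_factor (Suc b) irreducible u \<and>
        list_prod G letter w = \<iota> n \<otimes> list_prod G lift u \<and>
        fst (config_after M w t) = (if u = [] then tm_accept M else tm_reject M) \<and>
        output_tape (config_after M w t) = tape_content (unary n)" if w: "w \<in> lists R" for w
  proof -
    obtain t j B n S where t: "t \<le> a * length w + k"
      and dehn: "(dehn_step ^^ j) ([], 0, 0, [], map Inl w) = (B, 0, n, S, [])"
      and full: "b \<le> length B \<or> S = []"
      and M_run: "fst (config_after M w t) = (if B = [] then tm_accept M else tm_reject M)"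
        "output_tape (config_after M w t) = tape_content (unary n)"
      using bspec[OF run w] by blast
    have "B = [] \<longleftrightarrow> rev S @ B = []" using full b by auto
    then show ?thesis
      using t M_run dehn_run[OF w dehn]
      by (intro exI[of _ t] conjI exI[of _ n] exI[of _ "rev S @ B"]) simp_all
  qed
  then show ?thesis using M by (intro exI[of _ M] exI[of _ a] exI[of _ k]) simp
qed

end

section \<open>Membership in the central subgroup in linear time\<close>

theorem proposition3p2:
  fixes G :: "('g, 'm) monoid_scheme" and H :: "('h, 'n) monoid_scheme"
    and \<iota> :: "int \<Rightarrow> 'g" and \<pi> :: "'g \<Rightarrow> 'h" and X :: "'g set"
  assumes "hyperbolic_group H"
    and "Z_central_extension G H \<iota> \<pi>"
    and "finite_generating_set G X"
  shows "\<exists>(M :: ('g \<times> bool) turing_machine) (a :: nat) (b :: nat).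
           valid_tm M \<and> Letter ` (X \<times> UNIV) \<subseteq> tm_alphabet M \<and>
           decides_and_computes M (words X) (Z_value G \<iota>) (\<lambda>n. a * n + b)"
proof -
  interpret G: group G using assms(2) by (simp add: Z_central_extension_def)
  interpret H: group H using assms(2) by (simp add: Z_central_extension_def)
  have iota: "\<iota> \<in> hom integer_group G" "inj \<iota>" and pi: "\<pi> \<in> hom G H" "\<pi> ` carrier G = carrier H"
    and ker: "range \<iota> = kernel G H \<pi>"
    and central: "\<And>n g. g \<in> carrier G \<Longrightarrow> \<iota> n \<otimes>\<^bsub>G\<^esub> g = g \<otimes>\<^bsub>G\<^esub> \<iota> n"
    using assms(2) by (auto simp: Z_central_extension_def mon_def epi_def)
  have X: "finite X" "X \<subseteq> carrier G" using assms(3) by (auto simp: finite_generating_set_def)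
  obtain Y \<delta> where gen: "finite_generating_set H Y"
    and hyp: "gromov_hyperbolic_on (carrier H) (word_dist H Y) \<delta>"
    using assms(1) by (auto simp: hyperbolic_group_def)
  have Y: "finite Y" "Y \<subseteq> carrier H" "generate H Y = carrier H"
    using gen by (auto simp: finite_generating_set_def)
  \<comment> \<open>the buffer has length \<open>2m - 1\<close>, so that rules apply to words of length \<open>2m\<close>\<close>
  define m where "m = nat \<lceil>2 * \<delta>\<rceil> + 1"
  have m: "real m > 2 * \<delta>" "m > 0" unfolding m_def by linarith+
  define R where "R = X \<times> (UNIV :: bool set)"
  define A where "A = Y \<times> (UNIV :: bool set)"
  have words: "words X = lists R" "words Y = lists A" by (simp_all add: words_def R_def A_def)
  have "\<exists>g. g \<in> carrier G \<and> \<pi> g = letter_val H l" if "l \<in> A" for l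
    using H.letter_val_closed[OF Y(2), of l] pi(2) that unfolding A_def by (metis imageE)
  then obtain lift where lift: "\<And>l. l \<in> A \<Longrightarrow> lift l \<in> carrier G \<and> \<pi> (lift l) = letter_val H l"
    by metis
  have lift_word: "list_prod G lift u \<in> carrier G" "\<pi> (list_prod G lift u) = word_val H u"
    if "u \<in> words Y" for u
  proof -
    have u: "set u \<subseteq> A" using that by (auto simp: words)
    show "list_prod G lift u \<in> carrier G" using u lift by (intro G.list_prod_closed) auto
    have "\<pi> (list_prod G lift u) = list_prod H (\<pi> \<circ> lift) u"
      using u lift by (intro G.list_prod_hom H.is_group pi) auto
    also have "\<dots> = word_val H u"
      unfolding word_val_eq_list_prod using u lift by (intro list_prod_cong) auto
    finally show "\<pi> (list_prod G lift u) = word_val H u" .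
  qed
  \<comment> \<open>elements with the same image differ by a central integer; this is where all offsets come from\<close>
  have offset: "\<exists>k. g = \<iota> k \<otimes>\<^bsub>G\<^esub> h"
    if "g \<in> carrier G" "h \<in> carrier G" "\<pi> g = \<pi> h" for g h
  proof -
    have "\<pi> (g \<otimes>\<^bsub>G\<^esub> inv\<^bsub>G\<^esub> h) = \<pi> h \<otimes>\<^bsub>H\<^esub> inv\<^bsub>H\<^esub> \<pi> h"
      using that hom_mult[OF pi(1)] group_hom.hom_inv[of G H \<pi> h] pi(1)
      by (simp add: group_hom_def group_hom_axioms_def)
    also have "\<dots> = \<one>\<^bsub>H\<^esub>" using that pi(2) by (intro H.r_inv) auto
    finally have "g \<otimes>\<^bsub>G\<^esub> inv\<^bsub>G\<^esub> h \<in> range \<iota>" unfolding ker using that by (simp add: kernel_def)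
    then obtain k where "\<iota> k = g \<otimes>\<^bsub>G\<^esub> inv\<^bsub>G\<^esub> h" by auto
    then have "g = \<iota> k \<otimes>\<^bsub>G\<^esub> h" using that by (simp add: G.m_assoc)
    then show ?thesis ..
  qed
  have "\<exists>v k. v \<in> words Y \<and> letter_val G r = \<iota> k \<otimes>\<^bsub>G\<^esub> list_prod G lift v" if "r \<in> R" for r
  proof -
    have r: "letter_val G r \<in> carrier G" using G.letter_val_closed[OF X(2)] that by (simp add: R_def)
    then have "\<pi> (letter_val G r) \<in> generate H Y" using pi(2) Y(3) by auto
    then obtain v where "v \<in> words Y" "word_val H v = \<pi> (letter_val G r)"
      using H.generate_imp_word[OF Y(2)] by blast
    then show ?thesis using offset[OF r lift_word(1)[of v]] lift_word(2)[of v] by metis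
  qed
  then obtain tr tr_off where tr: "\<And>r. r \<in> R \<Longrightarrow> tr r \<in> words Y \<and>
      letter_val G r = \<iota> (tr_off r) \<otimes>\<^bsub>G\<^esub> list_prod G lift (tr r)" by metis
  have "\<exists>v k. v \<in> words Y \<and> length v < length u \<and>
      list_prod G lift u = \<iota> k \<otimes>\<^bsub>G\<^esub> list_prod G lift v"
    if u: "u \<in> words Y" "\<not> geodesic H Y u" for u
  proof -
    obtain v where "v \<in> words Y" "length v < length u" "word_val H v = word_val H u"
      using H.not_geodesic_imp_shorter[OF Y(2) u] by blast
    then show ?thesis
      using offset[OF lift_word(1)[OF u(1)] lift_word(1)[of v]] lift_word(2)[of v]
        lift_word(2)[OF u(1)] by metis
  qed
  then obtain red red_off where red: "\<And>u. u \<in> words Y \<Longrightarrow> \<not> geodesic H Y u \<Longrightarrow>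
      red u \<in> words Y \<and> length (red u) < length u \<and>
      list_prod G lift u = \<iota> (red_off u) \<otimes>\<^bsub>G\<^esub> list_prod G lift (red u)" by metis
  define U where "U = {u. set u \<subseteq> A \<and> length u \<le> 2 * m}"
  have fin: "finite R" "finite A" "finite U"
    using X Y finite_lists_length_le[of A "2 * m"] by (simp_all add: R_def A_def U_def)
  define N where "N = (\<Sum>r\<in>R. length (tr r) + nat \<bar>tr_off r\<bar>) + (\<Sum>u\<in>U. nat \<bar>red_off u\<bar>)"
  have N_R: "length (tr r) + nat \<bar>tr_off r\<bar> \<le> N" if "r \<in> R" for r
    using member_le_sum[of r R "\<lambda>r. length (tr r) + nat \<bar>tr_off r\<bar>"] fin that by (simp add: N_def)
  have N_U: "nat \<bar>red_off u\<bar> \<le> N" if "u \<in> U" for u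
    using member_le_sum[of u U "\<lambda>u. nat \<bar>red_off u\<bar>"] fin that by (simp add: N_def)
  have "central_dehn_algorithm R A (2 * m - 1) N tr tr_off (geodesic H Y) red red_off
    G \<iota> (letter_val G) lift"
  proof
    show "tr r \<in> lists A \<and> length (tr r) \<le> N \<and> \<bar>tr_off r\<bar> \<le> int N" if "r \<in> R" for r
      using tr[OF that] N_R[OF that] by (auto simp: words)
    show "red u \<in> lists A \<and> length (red u) < length u \<and> \<bar>red_off u\<bar> \<le> int N"
      if "u \<in> lists A" "length u \<le> Suc (2 * m - 1)" "\<not> geodesic H Y u" for u
    proof -
      have "u \<in> U" using that m(2) by (auto simp: U_def)
      then show ?thesis using red[of u] N_U[of u] that words by auto
    qed
    show "geodesic H Y []" by (simp add: geodesic_def word_val_def)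
    show "geodesic H Y u" if "p @ u \<in> lists A" "geodesic H Y (p @ u)" for p u
      using H.geodesic_suffix[OF Y(2)] that words by metis
    show "letter_val G r \<in> carrier G" if "r \<in> R" for r
      using G.letter_val_closed[OF X(2)] that by (simp add: R_def)
    show "finite R" "finite A" "0 < 2 * m - 1" "\<iota> \<in> hom integer_group G"
      using fin m(2) iota(1) by simp_all
    show "\<iota> n \<otimes>\<^bsub>G\<^esub> g = g \<otimes>\<^bsub>G\<^esub> \<iota> n" if "g \<in> carrier G" for g n
      by (rule central[OF that])
    show "lift l \<in> carrier G" if "l \<in> A" for l using lift[OF that] by simp
    show "letter_val G r = \<iota> (tr_off r) \<otimes>\<^bsub>G\<^esub> list_prod G lift (tr r)" if "r \<in> R" for r
      using tr[OF that] by (elim conjE)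
    show "list_prod G lift u = \<iota> (red_off u) \<otimes>\<^bsub>G\<^esub> list_prod G lift (red u)"
      if "u \<in> lists A" "\<not> geodesic H Y u" for u
      using red[OF that(1)[folded words] that(2)] by (elim conjE)
  qed
  note algorithm = central_dehn_algorithm.machine_reduces_input[OF this]
  obtain M :: "('g \<times> bool) turing_machine" and a k where M: "valid_tm M"
      "Letter ` R \<subseteq> tm_alphabet M"
    and run: "\<forall>w \<in> lists R. \<exists>t \<le> a * length w + k. \<exists>n u.
        u \<in> lists A \<and> every_factor (Suc (2 * m - 1)) (geodesic H Y) u \<and>
        list_prod G (letter_val G) w = \<iota> n \<otimes>\<^bsub>G\<^esub> list_prod G lift u \<and>
        fst (config_after M w t) = (if u = [] then tm_accept M else tm_reject M) \<and>
        output_tape (config_after M w t) = tape_content (unary n)"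
    using algorithm by (elim exE conjE)
  have "decides_and_computes M (words X) (Z_value G \<iota>) (\<lambda>n. a * n + k)"
    unfolding decides_and_computes_def
  proof
    fix w assume "w \<in> words X"
    then have w: "w \<in> lists R" by (simp add: words)
    obtain t n u where t: "t \<le> a * length w + k"
      and u: "u \<in> words Y" "every_factor (2 * m) (geodesic H Y) u"
      and val: "word_val G w = \<iota> n \<otimes>\<^bsub>G\<^esub> list_prod G lift u"
      and M_run: "fst (config_after M w t) = (if u = [] then tm_accept M else tm_reject M)"
        "output_tape (config_after M w t) = tape_content (unary n)"
      using bspec[OF run w] m(2) unfolding words word_val_eq_list_prod by auto
    have iota_closed: "\<iota> n \<in> carrier G" using iota(1) by (auto simp: hom_def)
    have "case Z_value G \<iota> w of
        None \<Rightarrow> fst (config_after M w t) = tm_reject M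
      | Some n \<Rightarrow> fst (config_after M w t) = tm_accept M \<and>
          output_tape (config_after M w t) = tape_content (unary n)"
    proof (cases "u = []")
      case True
      then have "word_val G w = \<iota> n" using val iota_closed by simp
      then have "Z_value G \<iota> w = Some n" using iota(2) by (simp add: Z_value_def inj_eq)
      then show ?thesis using M_run True by simp
    next
      case False
      have "\<pi> (\<iota> n) = \<one>\<^bsub>H\<^esub>" using ker by (auto simp: kernel_def)
      then have "\<pi> (word_val G w) = word_val H u"
        unfolding val using hom_mult[OF pi(1) iota_closed lift_word(1)[OF u(1)]] lift_word(2)[OF u(1)]
          H.word_val_closed[OF Y(2) u(1)] by simp
      moreover have "word_val H u \<noteq> \<one>\<^bsub>H\<^esub>"
        using H.locally_geodesic_word_nontrivial[OF gen hyp m(1) u(1,2)] False by simp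
      ultimately have "word_val G w \<notin> range \<iota>" unfolding ker by (simp add: kernel_def)
      then have "Z_value G \<iota> w = None" by (simp add: Z_value_def)
      then show ?thesis using M_run False by simp
    qed
    then show "\<exists>t \<le> a * length w + k. case Z_value G \<iota> w of
        None \<Rightarrow> fst (config_after M w t) = tm_reject M
      | Some n \<Rightarrow> fst (config_after M w t) = tm_accept M \<and>
          output_tape (config_after M w t) = tape_content (unary n)"
      using t by blast
  qed
  then show ?thesis using M unfolding R_def by (intro exI[of _ M] exI[of _ a] exI[of _ k] conjI)
qed

end
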